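(* Let $s>1$, let $U$ be a bounded open set in $\mathbb{R}^d$, $1\le p<\infty$ and $h_1>h>0$. We have the continuous inclusions $$\mathcal{D}^{(s)}_{L^\infty,h_1}(U)\to\mathcal{D}^{(s)}_{L^p,h}(U)\quad\text{and}\quad \mathcal{D}^{(s)}_{L^p,2^sh}(U)\to\mathcal{D}^{(s)}_{L^\infty,h}(U).$$ In particular, the spaces $\mathcal{D}^{(s)}_{L^p}(U)$, $1\le p<\infty$, and $\dot{\mathcal{B}}^{(s)}(U)$ are isomorphic among each other.
   Context: $D^\alpha=D_1^{\alpha_1}\cdots D_d^{\alpha_d}$ with $D_j=i^{-1}\partial_{x_j}$. $\mathcal{D}^{(s)}(U)$: all $\varphi\in\mathcal{C}^\infty(U)$ with compact support in $U$ such that $\sup_{\alpha,x}|D^\alpha\varphi(x)|/(k^{|\alpha|}\alpha!^s)<\infty$ for every $k>0$. $\mathcal{D}^s_{L^p,h}(U)$, $1\le p\le\infty$, $h>0$, is the Banach space of all $\varphi\in\mathcal{C}^\infty(U)$ with finite norm $\left(\sum_{\alpha\in\mathbb{N}^d}h^{p|\alpha|}\|D^\alpha\varphi\|_{L^p(U)}^p/\alpha!^{ps}\right)^{1/p}$ (for $p=\infty$: $\sup_\alpha h^{|\alpha|}\|D^\alpha\varphi\|_{L^\infty(U)}/\alpha!^s$). $\mathcal{D}^{(s)}_{L^p,h}(U)$ is the closure of $\mathcal{D}^{(s)}(U)$ in $\mathcal{D}^s_{L^p,h}(U)$. $\mathcal{B}^{(s)}_{L^p}(U)=\varprojlim_{h\to\infty}\mathcal{D}^s_{L^p,h}(U)$;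 $\mathcal{D}^{(s)}_{L^p}(U)$, $1\le p<\infty$, is the closure of $\mathcal{D}^{(s)}(U)$ in $\mathcal{B}^{(s)}_{L^p}(U)$, and $\dot{\mathcal{B}}^{(s)}(U)$ is the closure of $\mathcal{D}^{(s)}(U)$ in $\mathcal{B}^{(s)}_{L^\infty}(U)$. Isomorphic means isomorphic as locally convex spaces. *)

theory Defs
  imports "HOL-Analysis.Analysis" "HOL-Probability.Essential_Supremum"
begin

text \<open>
  Functions on an open set \<open>U\<close> of $\mathbb{R}^d$ are represented by total functions that vanish
  outside \<open>U\<close>, so that equality of functions on \<open>U\<close> is HOL equality. Values of derivatives outside
  \<open>U\<close> carry no information and are never used.
\<close>

definition partial_deriv :: "'n::finite \<Rightarrow> (real^'n::_ \<Rightarrow> complex) \<Rightarrow> real^'n::_ \<Rightarrow> complex" where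
  "partial_deriv j f = (\<lambda>x. vector_derivative (\<lambda>t. f (x + t *\<^sub>R axis j 1)) (at 0))"

definition smooth_fns :: "(real^'n::finite) set \<Rightarrow> (real^'n::_ \<Rightarrow> complex) set" where
  "smooth_fns U = {f. (\<forall>x. x \<notin> U \<longrightarrow> f x = 0) \<and>
     (\<forall>js. continuous_on U (foldr partial_deriv js f) \<and>
           (\<forall>x\<in>U. \<forall>j. (\<lambda>t. foldr partial_deriv js f (x + t *\<^sub>R axis j 1)) differentiable (at 0)))}"

definition D_op :: "'n::finite \<Rightarrow> (real^'n::_ \<Rightarrow> complex) \<Rightarrow> real^'n::_ \<Rightarrow> complex" where
  "D_op j f = (\<lambda>x. inverse \<i> * partial_deriv j f x)"

text \<open>
  Multi-indices are functions on the index type. Its linear order only serves to fix the order of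
  composition in $D^\alpha = D_1^{\alpha_1} \cdots D_d^{\alpha_d}$.
\<close>

definition D_multi ::
    "('n::{finite,linorder} \<Rightarrow> nat) \<Rightarrow> (real^'n::_ \<Rightarrow> complex) \<Rightarrow> real^'n::_ \<Rightarrow> complex" where
  "D_multi \<alpha> f = foldr (\<lambda>j. D_op j ^^ \<alpha> j) (sorted_list_of_set UNIV) f"

definition midx_abs :: "('n::finite \<Rightarrow> nat) \<Rightarrow> nat" where
  "midx_abs \<alpha> = (\<Sum>j\<in>UNIV. \<alpha> j)"

definition midx_fact :: "('n::finite \<Rightarrow> nat) \<Rightarrow> real" where
  "midx_fact \<alpha> = (\<Prod>j\<in>UNIV. fact (\<alpha> j))"

definition test_fns :: "real \<Rightarrow> (real^'n::{finite,linorder}) set \<Rightarrow> (real^'n::_ \<Rightarrow> complex) set" where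
  "test_fns s U = {f \<in> smooth_fns U.
     compact (closure {x. f x \<noteq> 0}) \<and> closure {x. f x \<noteq> 0} \<subseteq> U \<and>
     (\<forall>k>0. bdd_above {cmod (D_multi \<alpha> f x) / (k ^ midx_abs \<alpha> * midx_fact \<alpha> powr s) | \<alpha> x. x \<in> U})}"

text \<open>Powers with exponent \<open>a > 0\<close> of extended nonnegative reals.\<close>

definition ennpowr :: "ennreal \<Rightarrow> real \<Rightarrow> ennreal" where
  "ennpowr x a = (if x = \<infinity> then \<infinity> else ennreal (enn2real x powr a))"

definition Lp_norm :: "ennreal \<Rightarrow> (real^'n::finite) set \<Rightarrow> (real^'n::_ \<Rightarrow> complex) \<Rightarrow> ennreal" where
  "Lp_norm p U f =
     (if p = \<infinity> then esssup (restrict_space lborel U) (\<lambda>x. ennreal (cmod (f x)))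
      else ennpowr (\<integral>\<^sup>+x. ennreal (cmod (f x) powr enn2real p) \<partial>restrict_space lborel U)
             (1 / enn2real p))"

text \<open>
  The norm of $\mathcal{D}^s_{L^p,h}(U)$ on $\mathcal{C}^\infty(U)$, with value \<open>\<infinity>\<close> if the defining
  expression diverges. The value \<open>\<infinity>\<close> off $\mathcal{C}^\infty(U)$ makes the induced distance
  symmetric on the whole function type, as the locale \<^locale>\<open>Metric_space\<close> demands.
\<close>

definition gevrey_norm ::
    "real \<Rightarrow> ennreal \<Rightarrow> real \<Rightarrow> (real^'n::{finite,linorder}) set \<Rightarrow> (real^'n::_ \<Rightarrow> complex) \<Rightarrow> ennreal" where
  "gevrey_norm s p h U f =
     (if f \<notin> smooth_fns U then \<infinity>
      else let w = (\<lambda>\<alpha>. ennreal (h ^ midx_abs \<alpha> / midx_fact \<alpha> powr s) * Lp_norm p U (D_multi \<alpha> f))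
        in if p = \<infinity> then (SUP \<alpha>. w \<alpha>)
           else ennpowr (\<Sum>\<^sub>\<infinity>\<alpha>. ennpowr (w \<alpha>) (enn2real p)) (1 / enn2real p))"

definition gevrey_space ::
    "real \<Rightarrow> ennreal \<Rightarrow> real \<Rightarrow> (real^'n::{finite,linorder}) set \<Rightarrow> (real^'n::_ \<Rightarrow> complex) set" where
  "gevrey_space s p h U = {f \<in> smooth_fns U. gevrey_norm s p h U f < \<infinity>}"

definition gevrey_top ::
    "real \<Rightarrow> ennreal \<Rightarrow> real \<Rightarrow> (real^'n::{finite,linorder}) set \<Rightarrow> (real^'n::_ \<Rightarrow> complex) topology" where
  "gevrey_top s p h U =
     Metric_space.mtopology (gevrey_space s p h U)
       (\<lambda>f g. enn2real (gevrey_norm s p h U (\<lambda>x. f x - g x)))"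

text \<open>The space $\mathcal{D}^{(s)}_{L^p,h}(U)$; its carrier is the topspace.\<close>

definition gevrey_closure ::
    "real \<Rightarrow> ennreal \<Rightarrow> real \<Rightarrow> (real^'n::{finite,linorder}) set \<Rightarrow> (real^'n::_ \<Rightarrow> complex) topology" where
  "gevrey_closure s p h U =
     subtopology (gevrey_top s p h U) (gevrey_top s p h U closure_of test_fns s U)"

text \<open>
  The space $\mathcal{B}^{(s)}_{L^p}(U)$. The linking maps of the projective limit are inclusions, so
  it is the intersection of the spaces $\mathcal{D}^s_{L^p,h}(U)$, \<open>h > 0\<close>, with the coarsest
  topology that makes the inclusions into all of them continuous.
\<close>

definition B_top ::
    "real \<Rightarrow> ennreal \<Rightarrow> (real^'n::{finite,linorder}) set \<Rightarrow> (real^'n::_ \<Rightarrow> complex) topology" where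
  "B_top s p U =
     topology_generated_by
       {(\<Inter>h\<in>{0<..}. gevrey_space s p h U) \<inter> V | h V. 0 < h \<and> openin (gevrey_top s p h U) V}"

text \<open>
  The closure of $\mathcal{D}^{(s)}(U)$ in $\mathcal{B}^{(s)}_{L^p}(U)$, i.e. $\mathcal{D}^{(s)}_{L^p}(U)$
  for \<open>p < \<infinity>\<close> and $\dot{\mathcal{B}}^{(s)}(U)$ for \<open>p = \<infinity>\<close>.
\<close>

definition B_closure ::
    "real \<Rightarrow> ennreal \<Rightarrow> (real^'n::{finite,linorder}) set \<Rightarrow> (real^'n::_ \<Rightarrow> complex) topology" where
  "B_closure s p U = subtopology (B_top s p U) (B_top s p U closure_of test_fns s U)"

abbreviation D_Lp ::
    "real \<Rightarrow> ennreal \<Rightarrow> (real^'n::{finite,linorder}) set \<Rightarrow> (real^'n::_ \<Rightarrow> complex) topology" where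
  "D_Lp s p U \<equiv> B_closure s p U"

abbreviation B_dot ::
    "real \<Rightarrow> (real^'n::{finite,linorder}) set \<Rightarrow> (real^'n::_ \<Rightarrow> complex) topology" where
  "B_dot s U \<equiv> B_closure s \<infinity> U"

text \<open>
  Isomorphism of locally convex spaces of complex-valued functions with pointwise operations:
  a linear homeomorphism.
\<close>

definition lcs_isomorphic ::
    "('a \<Rightarrow> complex) topology \<Rightarrow> ('b \<Rightarrow> complex) topology \<Rightarrow> bool" where
  "lcs_isomorphic X Y \<longleftrightarrow>
     (\<exists>T. homeomorphic_map X Y T \<and>
          (\<forall>f\<in>topspace X. \<forall>g\<in>topspace X. \<forall>a b.
             T (\<lambda>x. a * f x + b * g x) = (\<lambda>x. a * T f x + b * T g x)))"

end

theory Submission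
  imports Defs
begin

text \<open>
  On test functions, $|D^\alpha\varphi(x)| \le \int |\partial_1 \cdots \partial_d D^\alpha\varphi|$ by
  integrating in one coordinate after the other, and Hoelder's inequality on the bounded set \<open>U\<close>
  bounds the supremum of $D^\alpha\varphi$ by the \<open>L\<^sup>p\<close> norm of $D^{\alpha+(1,\dots,1)}\varphi$. Passing from
  \<open>\<alpha>\<close> to $\alpha+(1,\dots,1)$ costs the factor $\prod_j(\alpha_j+1)^s \le 2^{s|\alpha|}$ in the weights, which is
  absorbed by replacing \<open>h\<close> with \<open>2\<^sup>s h\<close>; the estimate extends to the closure of the test functions.
  Conversely, boundedness of \<open>U\<close> and the convergence of $\sum_\alpha (h/h_1)^{p|\alpha|}$ bound the \<open>L\<^sup>p\<close>
  norm at \<open>h\<close> by the supremum norm at \<open>h\<^sub>1\<close>. Hence for all \<open>p\<close> the projective limits have the same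
  closure of the test functions, with the same topology.
\<close>

subsection \<open>Spaces defined by extended norms\<close>

text \<open>A smooth function on \<open>U\<close> with finite norm need not vanish at the boundary,
  so integrating from outside the support is possible for test functions only. The supremum bound
  therefore lives on the closure of the test functions. Continuity of an inclusion applies it to
  differences, which is why stability of the closure under differences matters. Approximants
  converge in L^p only, so the bound cannot be passed to the limit pointwise; Chebyshev's inequality
  shows instead that it fails at most on a null set, and an open null set is empty. The sorted order
  of composition in D^\<alpha> does not match the prefix (1,...,1) produced by the integration.
  Mixed partial derivatives must therefore commute, which is derived from smoothness in the sense of
  continuous iterated partial derivatives. The constant is (|U| + 1) / (2^s h)^d: |U| + 1 takes the
  place of the factor |U|^(1-1/p) of Hoelder's inequality, and the d powers of 2^s h are left over
  when the order rises by d.\<close>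

definition norm_top :: "(('a \<Rightarrow> complex) \<Rightarrow> ennreal) \<Rightarrow> ('a \<Rightarrow> complex) topology" where
  "norm_top N = Metric_space.mtopology {f. N f < \<infinity>} (\<lambda>f g. enn2real (N (\<lambda>x. f x - g x)))"

definition norm_closure :: "(('a \<Rightarrow> complex) \<Rightarrow> ennreal) \<Rightarrow> ('a \<Rightarrow> complex) set \<Rightarrow> ('a \<Rightarrow> complex) set" where
  "norm_closure N T = {f. N f < \<infinity> \<and> (\<forall>e>0. \<exists>g\<in>T. N (\<lambda>x. f x - g x) < ennreal e)}"

text \<open>A group norm with values in [0, infinity]: what makes
  \<open>N (\<lambda>x. f x - g x)\<close> a metric on the functions of finite norm. The value
  infinity lets one total function describe both the norm and its carrier.\<close>

locale ext_norm =
  fixes N :: "('a \<Rightarrow> complex) \<Rightarrow> ennreal"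
  assumes zero: "N (\<lambda>_. 0) = 0"
    and eq_zero: "N f = 0 \<Longrightarrow> f = (\<lambda>_. 0)"
    and minus: "N (\<lambda>x. - f x) = N f"
    and add: "N (\<lambda>x. f x + g x) \<le> N f + N g"
begin

lemma minus_commute: "N (\<lambda>x. f x - g x) = N (\<lambda>x. g x - f x)"
  using minus[of "\<lambda>x. f x - g x"] by simp

lemma triangle: "N (\<lambda>x. f x - h x) \<le> N (\<lambda>x. f x - g x) + N (\<lambda>x. g x - h x)"
  using add[of "\<lambda>x. f x - g x" "\<lambda>x. g x - h x"] by simp

lemma diff_le: "N (\<lambda>x. f x - g x) \<le> N f + N g"
  using add[of f "\<lambda>x. - g x"] by (simp add: minus)

lemma le_diff_add: "N g \<le> N (\<lambda>x. f x - g x) + N f"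
  using diff_le[of f "\<lambda>x. f x - g x"] by (simp add: add_ac)

lemma diff_finite: "N f < \<infinity> \<Longrightarrow> N g < \<infinity> \<Longrightarrow> N (\<lambda>x. f x - g x) < \<infinity>"
  using diff_le[of f g] by (auto simp: ennreal_add_less_top less_top intro: le_less_trans)

lemma finite_of_diff: "N f < \<infinity> \<Longrightarrow> N (\<lambda>x. f x - g x) < \<infinity> \<Longrightarrow> N g < \<infinity>"
  using le_diff_add[of g f] by (auto simp: ennreal_add_less_top less_top intro: le_less_trans)

lemma dist_less_iff:
  assumes "N f < \<infinity>" "N g < \<infinity>"
  shows "enn2real (N (\<lambda>x. f x - g x)) < e \<longleftrightarrow> N (\<lambda>x. f x - g x) < ennreal e"
  using diff_finite[OF assms] by (cases "N (\<lambda>x. f x - g x)") (auto simp: ennreal_less_iff)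

lemma Metric_space: "Metric_space {f. N f < \<infinity>} (\<lambda>f g. enn2real (N (\<lambda>x. f x - g x)))"
proof
  fix f g h :: "'a \<Rightarrow> complex"
  show "enn2real (N (\<lambda>x. f x - g x)) = enn2real (N (\<lambda>x. g x - f x))"
    by (rule arg_cong[OF minus_commute])
  assume fg: "f \<in> {f. N f < \<infinity>}" "g \<in> {f. N f < \<infinity>}"
  then have fin: "N (\<lambda>x. f x - g x) < \<infinity>" by (blast intro: diff_finite)
  have "enn2real (N (\<lambda>x. f x - g x)) = 0 \<longleftrightarrow> N (\<lambda>x. f x - g x) = 0"
    using fin by (auto simp: enn2real_eq_0_iff)
  also have "\<dots> \<longleftrightarrow> f = g"
    using eq_zero[of "\<lambda>x. f x - g x"] zero by (fastforce simp: fun_eq_iff)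
  finally show "enn2real (N (\<lambda>x. f x - g x)) = 0 \<longleftrightarrow> f = g" .
  assume "h \<in> {f. N f < \<infinity>}"
  then have fin': "N (\<lambda>x. g x - h x) < \<infinity>" using fg by (blast intro: diff_finite)
  show "enn2real (N (\<lambda>x. f x - h x)) \<le> enn2real (N (\<lambda>x. f x - g x)) + enn2real (N (\<lambda>x. g x - h x))"
    using enn2real_mono[OF triangle[of f h g]] fin fin'
    by (simp add: enn2real_plus)
qed simp

lemma mball_eq:
  assumes "N f < \<infinity>"
  shows "Metric_space.mball {f. N f < \<infinity>} (\<lambda>f g. enn2real (N (\<lambda>x. f x - g x))) f e =
           {g. N g < \<infinity> \<and> N (\<lambda>x. f x - g x) < ennreal e}"
  unfolding Metric_space.mball_def[OF Metric_space] using assms dist_less_iff by blast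

lemma openin_norm_ball:
  "N f < \<infinity> \<Longrightarrow> openin (norm_top N) {g. N g < \<infinity> \<and> N (\<lambda>x. f x - g x) < ennreal e}"
  unfolding norm_top_def mball_eq[symmetric] by (rule Metric_space.openin_mball[OF Metric_space])

lemma openin_norm_top:
  "openin (norm_top N) W \<longleftrightarrow> W \<subseteq> {f. N f < \<infinity>} \<and>
     (\<forall>f\<in>W. \<exists>e>0. \<forall>g. N g < \<infinity> \<longrightarrow> N (\<lambda>x. f x - g x) < ennreal e \<longrightarrow> g \<in> W)"
proof -
  have "W \<subseteq> {f. N f < \<infinity>} \<Longrightarrow> f \<in> W \<Longrightarrow>
    Metric_space.mball {f. N f < \<infinity>} (\<lambda>f g. enn2real (N (\<lambda>x. f x - g x))) f e \<subseteq> W \<longleftrightarrow>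
    (\<forall>g. N g < \<infinity> \<longrightarrow> N (\<lambda>x. f x - g x) < ennreal e \<longrightarrow> g \<in> W)" for f e
    by (subst mball_eq) auto
  then show ?thesis
    unfolding norm_top_def Metric_space.openin_mtopology[OF Metric_space] by blast
qed

text \<open>\<open>T\<close> may contain functions of infinite norm. An element at finite distance
  from a function of finite norm has finite norm itself, so no others can approximate.\<close>

lemma closure_of_norm_top: "norm_top N closure_of T = norm_closure N T"
proof -
  have "N f < \<infinity> \<Longrightarrow> (\<exists>g\<in>T. g \<in> {g. N g < \<infinity> \<and> N (\<lambda>x. f x - g x) < ennreal e}) \<longleftrightarrow>
      (\<exists>g\<in>T. N (\<lambda>x. f x - g x) < ennreal e)" for f e
    using finite_of_diff[of f] less_trans[OF _ ennreal_less_top[of e]] by auto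
  then show ?thesis
    unfolding norm_top_def Metric_space.metric_closure_of[OF Metric_space] norm_closure_def
    by (auto simp: mball_eq simp del: infinity_ennreal_def)
qed

text \<open>Estimates known only on the closure can be applied to a difference \<open>f - g\<close>
  of its elements, as continuity at \<open>f\<close> demands.\<close>

lemma norm_closure_diff:
  assumes T: "\<And>f g. f \<in> T \<Longrightarrow> g \<in> T \<Longrightarrow> (\<lambda>x. f x - g x) \<in> T"
    and f: "f \<in> norm_closure N T" and g: "g \<in> norm_closure N T"
  shows "(\<lambda>x. f x - g x) \<in> norm_closure N T"
  unfolding norm_closure_def
proof (safe)
  show "N (\<lambda>x. f x - g x) < \<infinity>"
    using f g unfolding norm_closure_def by (intro diff_finite) blast+
  fix e :: real assume "e > 0"
  then have "e / 2 > 0" by simp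
  then obtain f' g' where "f' \<in> T" and f': "N (\<lambda>x. f x - f' x) < ennreal (e / 2)"
    and "g' \<in> T" and g': "N (\<lambda>x. g x - g' x) < ennreal (e / 2)"
    using f g unfolding norm_closure_def by blast
  have "N (\<lambda>x. (f x - f' x) - (g x - g' x)) \<le> N (\<lambda>x. f x - f' x) + N (\<lambda>x. g x - g' x)"
    by (rule diff_le)
  also have "\<dots> < ennreal (e / 2) + ennreal (e / 2)"
    using f' g' by (rule add_strict_mono)
  also have "\<dots> = ennreal e" using \<open>e > 0\<close> by (simp flip: ennreal_plus)
  finally have "N (\<lambda>x. (f x - g x) - (f' x - g' x)) < ennreal e"
    by (simp add: algebra_simps)
  then show "\<exists>h\<in>T. N (\<lambda>x. f x - g x - h x) < ennreal e"
    using T[OF \<open>f' \<in> T\<close> \<open>g' \<in> T\<close>] by (rule bexI)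
qed

end

lemma ennreal_less_of_le_mult:
  assumes "0 < K" "0 < e" "a \<le> ennreal K * b" "b < ennreal (e / K)"
  shows "a < ennreal e"
proof -
  have "ennreal K * b < ennreal K * ennreal (e / K)"
    using assms by (intro ennreal_mult_strict_left_mono) auto
  also have "\<dots> = ennreal e" using assms by (simp flip: ennreal_mult)
  finally show ?thesis using assms by (rule_tac le_less_trans)
qed

text \<open>An element of the closure and its approximant from \<open>T\<close> both lie in
  \<open>norm_closure N T\<close>, hence so does their difference. The bound on that set then turns
  \<open>N\<close>-approximation into \<open>M\<close>-approximation.\<close>

lemma norm_closure_mono:
  assumes N: "ext_norm N"
    and T: "\<And>f g. f \<in> T \<Longrightarrow> g \<in> T \<Longrightarrow> (\<lambda>x. f x - g x) \<in> T"
    and TN: "\<And>f. f \<in> T \<Longrightarrow> N f < \<infinity>"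
    and K: "0 < K" and le: "\<And>f. f \<in> norm_closure N T \<Longrightarrow> M f \<le> ennreal K * N f"
  shows "norm_closure N T \<subseteq> norm_closure M T"
proof
  interpret N: ext_norm N by fact
  fix f assume f: "f \<in> norm_closure N T"
  then have "ennreal K * N f < \<infinity>" by (simp add: norm_closure_def ennreal_mult_less_top)
  then have "M f < \<infinity>" using le[OF f] by (rule le_less_trans[rotated])
  moreover have "\<exists>g\<in>T. M (\<lambda>x. f x - g x) < ennreal e" if "e > 0" for e
  proof -
    have "e / K > 0" using that K by simp
    then obtain g where g: "g \<in> T" "N (\<lambda>x. f x - g x) < ennreal (e / K)"
      using f unfolding norm_closure_def by blast
    have "g \<in> norm_closure N T"
      unfolding norm_closure_def using g(1) TN by (force simp: N.zero)
    then show ?thesis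
      using ennreal_less_of_le_mult[OF K that le[OF N.norm_closure_diff[OF T f]]] g by blast
  qed
  ultimately show "f \<in> norm_closure M T" by (simp add: norm_closure_def)
qed

lemma continuous_map_norm_closure:
  assumes N: "ext_norm N" and M: "ext_norm M"
    and T: "\<And>f g. f \<in> T \<Longrightarrow> g \<in> T \<Longrightarrow> (\<lambda>x. f x - g x) \<in> T"
    and TN: "\<And>f. f \<in> T \<Longrightarrow> N f < \<infinity>"
    and K: "0 < K" and le: "\<And>f. f \<in> norm_closure N T \<Longrightarrow> M f \<le> ennreal K * N f"
  shows "continuous_map (subtopology (norm_top N) (norm_top N closure_of T))
           (subtopology (norm_top M) (norm_top M closure_of T)) (\<lambda>f. f)"
proof -
  interpret N: ext_norm N by fact
  interpret M: ext_norm M by fact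
  have sub: "norm_closure N T \<subseteq> norm_closure M T"
    by (rule norm_closure_mono[OF N T TN K le])
  have "continuous_map (subtopology (norm_top N) (norm_closure N T)) (norm_top M) (\<lambda>f. f)"
    unfolding norm_top_def[of M] Metric_space.continuous_map_to_metric[OF M.Metric_space]
  proof safe
    fix f e assume "f \<in> topspace (subtopology (norm_top N) (norm_closure N T))" and e: "(e::real) > 0"
    then have f: "f \<in> norm_closure N T" by simp
    let ?W = "{g. N g < \<infinity> \<and> N (\<lambda>x. f x - g x) < ennreal (e / K)}"
    have "openin (norm_top N) ?W"
      using f by (intro N.openin_norm_ball) (simp add: norm_closure_def)
    then have "openin (subtopology (norm_top N) (norm_closure N T)) (?W \<inter> norm_closure N T)"
      by (rule openin_subtopology_Int)
    moreover have "f \<in> ?W \<inter> norm_closure N T"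
      using f e K by (simp add: norm_closure_def N.zero)
    moreover have "\<forall>g\<in>?W \<inter> norm_closure N T.
       g \<in> Metric_space.mball {f. M f < \<infinity>} (\<lambda>f g. enn2real (M (\<lambda>x. f x - g x))) f e"
    proof
      fix g assume g: "g \<in> ?W \<inter> norm_closure N T"
      have "M (\<lambda>x. f x - g x) < ennreal e"
        using g by (intro ennreal_less_of_le_mult[OF K e le[OF N.norm_closure_diff[OF T f]]]) auto
      moreover have "M f < \<infinity>" "M g < \<infinity>" using sub f g unfolding norm_closure_def by auto
      ultimately show "g \<in> Metric_space.mball {f. M f < \<infinity>} (\<lambda>f g. enn2real (M (\<lambda>x. f x - g x))) f e"
        by (simp add: M.mball_eq del: infinity_ennreal_def)
    qed
    ultimately show "\<exists>W. openin (subtopology (norm_top N) (norm_closure N T)) W \<and> f \<in> W \<and>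
       (\<forall>g\<in>W. g \<in> Metric_space.mball {f. M f < \<infinity>} (\<lambda>f g. enn2real (M (\<lambda>x. f x - g x))) f e)"
      by blast
  qed
  then show ?thesis
    unfolding N.closure_of_norm_top M.closure_of_norm_top
    using sub by (intro continuous_map_into_subtopology) auto
qed

section \<open>Projective limits of families of extended norms\<close>

definition proj_top :: "(real \<Rightarrow> ('a \<Rightarrow> complex) \<Rightarrow> ennreal) \<Rightarrow> ('a \<Rightarrow> complex) topology" where
  "proj_top N = topology_generated_by
     {(\<Inter>h\<in>{0<..}. {f. N h f < \<infinity>}) \<inter> V | h V. 0 < h \<and> openin (norm_top (N h)) V}"

text \<open>Monotonicity in \<open>h\<close> makes the family directed, so that balls of single
  norms form neighbourhood bases of the projective limit.\<close>

locale ext_norm_family =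
  fixes N :: "real \<Rightarrow> ('a \<Rightarrow> complex) \<Rightarrow> ennreal"
  assumes ext_norm: "0 < h \<Longrightarrow> ext_norm (N h)"
    and mono: "0 < h \<Longrightarrow> h \<le> h' \<Longrightarrow> N h f \<le> N h' f"
begin

definition carrier :: "('a \<Rightarrow> complex) set" where
  "carrier = (\<Inter>h\<in>{0<..}. {f. N h f < \<infinity>})"

lemma carrier_finite: "f \<in> carrier \<Longrightarrow> 0 < h \<Longrightarrow> N h f < \<infinity>"
  by (auto simp: carrier_def)

lemma openin_ball:
  assumes h: "0 < h" and f: "f \<in> carrier"
  shows "openin (proj_top N) {g \<in> carrier. N h (\<lambda>x. f x - g x) < ennreal e}"
proof -
  interpret ext_norm "N h" by (rule ext_norm[OF h])
  let ?V = "{g. N h g < \<infinity> \<and> N h (\<lambda>x. f x - g x) < ennreal e}"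
  have "N h f < \<infinity>" using f h by (rule carrier_finite)
  then have "openin (norm_top (N h)) ?V" by (rule openin_norm_ball)
  moreover have "{g \<in> carrier. N h (\<lambda>x. f x - g x) < ennreal e} = carrier \<inter> ?V"
    using h carrier_finite by auto
  ultimately show ?thesis
    unfolding proj_top_def carrier_def by (intro topology_generated_by_Basis) (use h in blast)
qed

lemma openin_proj_top:
  "openin (proj_top N) W \<longleftrightarrow> W \<subseteq> carrier \<and>
     (\<forall>f\<in>W. \<exists>h>0. \<exists>e>0. \<forall>g\<in>carrier. N h (\<lambda>x. f x - g x) < ennreal e \<longrightarrow> g \<in> W)"
    (is "?L \<longleftrightarrow> ?R W")
proof
  assume ?L
  then have "generate_topology_on
     {carrier \<inter> V | h V. 0 < h \<and> openin (norm_top (N h)) V} W"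
    unfolding proj_top_def carrier_def by (rule openin_topology_generated_by)
  then show "?R W"
  proof induction
    case Empty
    then show ?case by simp
  next
    case (Int a b)
    have "\<exists>h>0. \<exists>e>0. \<forall>g\<in>carrier. N h (\<lambda>x. f x - g x) < ennreal e \<longrightarrow> g \<in> a \<inter> b"
      if f: "f \<in> a \<inter> b" for f
    proof -
      obtain h e where h: "h > 0" "e > 0"
        and a: "\<And>g. g \<in> carrier \<Longrightarrow> N h (\<lambda>x. f x - g x) < ennreal e \<Longrightarrow> g \<in> a"
        using Int.IH(1) f by blast
      obtain h' e' where h': "h' > 0" "e' > 0"
        and b: "\<And>g. g \<in> carrier \<Longrightarrow> N h' (\<lambda>x. f x - g x) < ennreal e' \<Longrightarrow> g \<in> b"
        using Int.IH(2) f by blast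
      \<comment> \<open>The larger parameter dominates both norms, and the smaller radius meets both
        requirements.\<close>
      have "g \<in> a \<inter> b" if "g \<in> carrier" "N (max h h') (\<lambda>x. f x - g x) < ennreal (min e e')" for g
      proof -
        have "N h (\<lambda>x. f x - g x) < ennreal e" "N h' (\<lambda>x. f x - g x) < ennreal e'"
          using that(2) mono[of h "max h h'" "\<lambda>x. f x - g x"] mono[of h' "max h h'" "\<lambda>x. f x - g x"]
            h h' ennreal_leI[of "min e e'" e] ennreal_leI[of "min e e'" e']
          by (auto intro: le_less_trans less_le_trans)
        then show ?thesis using a b that(1) by blast
      qed
      then show ?thesis using h h' by (intro exI[of _ "max h h'"] exI[of _ "min e e'"] conjI) auto
    qed
    moreover have "a \<inter> b \<subseteq> carrier" using Int.IH(1) by blast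
    ultimately show ?case by (intro conjI ballI) assumption+
  next
    case (UN K)
    have "\<exists>h>0. \<exists>e>0. \<forall>g\<in>carrier. N h (\<lambda>x. f x - g x) < ennreal e \<longrightarrow> g \<in> \<Union>K"
      if f: "f \<in> k" and k: "k \<in> K" for f k
    proof -
      obtain h e where "h > 0" "e > 0"
        and sub: "\<forall>g\<in>carrier. N h (\<lambda>x. f x - g x) < ennreal e \<longrightarrow> g \<in> k"
        using UN.IH[OF k] f by blast
      moreover have "\<forall>g\<in>carrier. N h (\<lambda>x. f x - g x) < ennreal e \<longrightarrow> g \<in> \<Union>K"
        using sub k by (metis UnionI)
      ultimately show ?thesis by (intro exI conjI)
    qed
    moreover have "\<Union>K \<subseteq> carrier" using UN.IH by blast
    ultimately show ?case by (intro conjI ballI) (auto elim!: UnionE)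
  next
    case (Basis S)
    then obtain h V where S: "S = carrier \<inter> V" and h: "0 < h" and V: "openin (norm_top (N h)) V"
      by blast
    have "\<exists>e>0. \<forall>g\<in>carrier. N h (\<lambda>x. f x - g x) < ennreal e \<longrightarrow> g \<in> S" if f: "f \<in> S" for f
    proof -
      obtain e where "e > 0"
        "\<And>g. N h g < \<infinity> \<Longrightarrow> N h (\<lambda>x. f x - g x) < ennreal e \<Longrightarrow> g \<in> V"
        using V f unfolding S ext_norm.openin_norm_top[OF ext_norm[OF h]] by blast
      then show ?thesis using h carrier_finite unfolding S by (intro exI[of _ e]) auto
    qed
    then show ?case using h S by blast
  qed
next
  assume R: "?R W"
  have "\<exists>B. openin (proj_top N) B \<and> f \<in> B \<and> B \<subseteq> W" if f: "f \<in> W" for f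
  proof -
    obtain h e where h: "h > 0" and e: "e > 0"
      and sub: "\<And>g. g \<in> carrier \<Longrightarrow> N h (\<lambda>x. f x - g x) < ennreal e \<Longrightarrow> g \<in> W"
      using R f by blast
    have fc: "f \<in> carrier" using R f by blast
    show ?thesis
      using openin_ball[OF h fc, of e] fc sub e ext_norm.zero[OF ext_norm[OF h]]
      by (intro exI[of _ "{g \<in> carrier. N h (\<lambda>x. f x - g x) < ennreal e}"]) auto
  qed
  then show ?L by (subst openin_subopen) blast
qed

lemma openin_proj_topD:
  assumes "openin (proj_top N) W" "f \<in> W"
  shows "\<exists>h>0. \<exists>e>0. \<forall>g\<in>carrier. N h (\<lambda>x. f x - g x) < ennreal e \<longrightarrow> g \<in> W"
  using assms(1)[unfolded openin_proj_top] assms(2) by (elim conjE) (erule bspec)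

lemma topspace_proj_top: "topspace (proj_top N) = carrier"
proof (rule subset_antisym)
  show "topspace (proj_top N) \<subseteq> carrier"
    using openin_proj_top[of "topspace (proj_top N)"] by blast
  have "openin (proj_top N) carrier"
    unfolding openin_proj_top using zero_less_one[where 'a=real] by blast
  then show "carrier \<subseteq> topspace (proj_top N)" by (rule openin_subset)
qed

text \<open>The approximants may depend on \<open>h\<close>: every neighbourhood is controlled by a
  single norm, so none has to be close in all norms at once.\<close>

lemma closure_of_proj_top:
  assumes T: "T \<subseteq> carrier"
  shows "proj_top N closure_of T = (\<Inter>h\<in>{0<..}. norm_closure (N h) T)"
proof (rule subset_antisym; rule subsetI)
  fix f assume f: "f \<in> proj_top N closure_of T"
  then have fc: "f \<in> carrier" by (simp add: in_closure_of topspace_proj_top)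
  have "\<exists>g\<in>T. N h (\<lambda>x. f x - g x) < ennreal e" if "0 < h" "0 < e" for h e
  proof -
    have "f \<in> {g \<in> carrier. N h (\<lambda>x. f x - g x) < ennreal e}"
      using fc that ext_norm.zero[OF ext_norm[OF that(1)]] by simp
    then show ?thesis
      using f openin_ball[OF that(1) fc, of e] unfolding in_closure_of
      by (metis (no_types, lifting) mem_Collect_eq)
  qed
  then show "f \<in> (\<Inter>h\<in>{0<..}. norm_closure (N h) T)"
    using fc by (simp add: norm_closure_def carrier_def)
next
  fix f assume f: "f \<in> (\<Inter>h\<in>{0<..}. norm_closure (N h) T)"
  then have fc: "f \<in> carrier" by (simp add: norm_closure_def carrier_def)
  have "\<exists>g. g \<in> T \<and> g \<in> W" if fW: "f \<in> W" and oW: "openin (proj_top N) W" for W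
  proof -
    obtain h e where h: "h > 0" "e > 0"
      and sub: "\<forall>g\<in>carrier. N h (\<lambda>x. f x - g x) < ennreal e \<longrightarrow> g \<in> W"
      using openin_proj_topD[OF oW fW] by blast
    obtain g where "g \<in> T" "N h (\<lambda>x. f x - g x) < ennreal e"
      using f h unfolding norm_closure_def by fastforce
    then show ?thesis using sub T by blast
  qed
  then show "f \<in> proj_top N closure_of T"
    using fc by (auto simp: in_closure_of topspace_proj_top)
qed

end

text \<open>Continuity of the identity from the \<open>N\<close>-closure to the
  \<open>M\<close>-closure, phrased with open sets. The bound is applied to differences within the
  common closure, where a ball of radius \<open>e / K\<close> for \<open>N h'\<close> lies in one of
  radius \<open>e\<close> for \<open>M h\<close>.\<close>

lemma openin_proj_closure_mono:
  assumes N: "ext_norm_family N" and M: "ext_norm_family M"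
    and T: "\<And>f g. f \<in> T \<Longrightarrow> g \<in> T \<Longrightarrow> (\<lambda>x. f x - g x) \<in> T"
    and TN: "\<And>f h. f \<in> T \<Longrightarrow> 0 < h \<Longrightarrow> N h f < \<infinity>"
    and TM: "\<And>f h. f \<in> T \<Longrightarrow> 0 < h \<Longrightarrow> M h f < \<infinity>"
    and le: "\<And>h. 0 < h \<Longrightarrow> \<exists>h'>0. \<exists>K>0. \<forall>f\<in>norm_closure (N h') T. M h f \<le> ennreal K * N h' f"
    and eq: "proj_top N closure_of T = proj_top M closure_of T"
    and W: "openin (subtopology (proj_top M) (proj_top M closure_of T)) W"
  shows "openin (subtopology (proj_top N) (proj_top N closure_of T)) W"
proof -
  interpret N: ext_norm_family N by fact
  interpret M: ext_norm_family M by fact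
  define C where "C = proj_top N closure_of T"
  have TNc: "T \<subseteq> N.carrier" using TN by (auto simp: N.carrier_def)
  have C: "C = (\<Inter>h\<in>{0<..}. norm_closure (N h) T)"
    unfolding C_def by (rule N.closure_of_proj_top[OF TNc])
  have CM: "C \<subseteq> M.carrier"
    unfolding C_def eq using closure_of_subset_topspace[of "proj_top M" T] by (simp add: M.topspace_proj_top)
  obtain W' where W': "openin (proj_top M) W'" and WW: "W = W' \<inter> C"
    using W unfolding openin_subtopology C_def eq by auto
  have "\<exists>B. openin (proj_top N) B \<and> f \<in> B \<and> B \<inter> C \<subseteq> W" if f: "f \<in> W" for f
  proof -
    obtain h e where h: "h > 0" and e: "e > 0"
      and sub: "\<forall>g\<in>M.carrier. M h (\<lambda>x. f x - g x) < ennreal e \<longrightarrow> g \<in> W'"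
      using M.openin_proj_topD[OF W'] f WW by blast
    obtain h' K where h': "0 < h'" and K: "0 < K"
      and bound: "\<And>f. f \<in> norm_closure (N h') T \<Longrightarrow> M h f \<le> ennreal K * N h' f"
      using le[OF h] by blast
    have fC: "f \<in> C" using f WW by blast
    then have fc: "f \<in> N.carrier" unfolding C norm_closure_def N.carrier_def by blast
    let ?B = "{g \<in> N.carrier. N h' (\<lambda>x. f x - g x) < ennreal (e / K)}"
    have "?B \<inter> C \<subseteq> W"
    proof
      fix g assume g: "g \<in> ?B \<inter> C"
      have "(\<lambda>x. f x - g x) \<in> norm_closure (N h') T"
        using fC g h' unfolding C
        by (intro ext_norm.norm_closure_diff[OF N.ext_norm[OF h']] T) auto
      then have "M h (\<lambda>x. f x - g x) < ennreal e"
        using g by (intro ennreal_less_of_le_mult[OF K e bound]) auto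
      then show "g \<in> W" using sub g CM WW by blast
    qed
    moreover have "f \<in> ?B"
      using fc e K ext_norm.zero[OF N.ext_norm[OF h']] by simp
    ultimately show ?thesis using N.openin_ball[OF h' fc] by blast
  qed
  then obtain B where B: "\<And>f. f \<in> W \<Longrightarrow> openin (proj_top N) (B f) \<and> f \<in> B f \<and> B f \<inter> C \<subseteq> W"
    by metis
  then have "W = (\<Union>f\<in>W. B f) \<inter> C" using WW by blast
  moreover have "openin (proj_top N) (\<Union>f\<in>W. B f)" using B by blast
  ultimately show ?thesis unfolding openin_subtopology C_def by blast
qed

text \<open>Each comparison may lose in the parameter, from \<open>h\<close> to \<open>h'\<close>;
  since the limit involves all \<open>h\<close>, the two losses do not matter.\<close>

lemma proj_closure_eq:
  assumes N: "ext_norm_family N" and M: "ext_norm_family M"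
    and T: "\<And>f g. f \<in> T \<Longrightarrow> g \<in> T \<Longrightarrow> (\<lambda>x. f x - g x) \<in> T"
    and TN: "\<And>f h. f \<in> T \<Longrightarrow> 0 < h \<Longrightarrow> N h f < \<infinity>"
    and TM: "\<And>f h. f \<in> T \<Longrightarrow> 0 < h \<Longrightarrow> M h f < \<infinity>"
    and NM: "\<And>h. 0 < h \<Longrightarrow> \<exists>h'>0. \<exists>K>0. \<forall>f\<in>norm_closure (N h') T. M h f \<le> ennreal K * N h' f"
    and MN: "\<And>h. 0 < h \<Longrightarrow> \<exists>h'>0. \<exists>K>0. \<forall>f\<in>norm_closure (M h') T. N h f \<le> ennreal K * M h' f"
  shows "subtopology (proj_top N) (proj_top N closure_of T) =
         subtopology (proj_top M) (proj_top M closure_of T)"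
proof -
  \<comment> \<open>Formulated for arbitrary families, so that both inclusions are
    instances.\<close>
  have sub: "(\<Inter>h\<in>{0<..}. norm_closure (N h) T) \<subseteq> (\<Inter>h\<in>{0<..}. norm_closure (M h) T)"
    if N: "ext_norm_family N" and TN: "\<And>f h. f \<in> T \<Longrightarrow> 0 < h \<Longrightarrow> N h f < \<infinity>"
      and NM: "\<And>h. 0 < h \<Longrightarrow> \<exists>h'>0. \<exists>K>0. \<forall>f\<in>norm_closure (N h') T. M h f \<le> ennreal K * N h' f"
    for N M :: "real \<Rightarrow> ('a \<Rightarrow> complex) \<Rightarrow> ennreal"
  proof (rule INT_greatest)
    fix h :: real assume "h \<in> {0<..}"
    then obtain h' K where h': "0 < h'" and K: "0 < K"
      and le: "\<And>f. f \<in> norm_closure (N h') T \<Longrightarrow> M h f \<le> ennreal K * N h' f"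
      using NM[of h] by auto
    have "norm_closure (N h') T \<subseteq> norm_closure (M h) T"
      by (rule norm_closure_mono[OF ext_norm_family.ext_norm[OF N h'] T TN[OF _ h'] K le])
    then show "(\<Inter>h\<in>{0<..}. norm_closure (N h) T) \<subseteq> norm_closure (M h) T"
      using h' by blast
  qed
  have "T \<subseteq> ext_norm_family.carrier N" and "T \<subseteq> ext_norm_family.carrier M"
    using TN TM by (auto simp: ext_norm_family.carrier_def[OF N] ext_norm_family.carrier_def[OF M])
  note cl = ext_norm_family.closure_of_proj_top[OF N this(1)] ext_norm_family.closure_of_proj_top[OF M this(2)]
  have eq: "proj_top N closure_of T = proj_top M closure_of T"
    unfolding cl
    by (intro subset_antisym sub[OF N TN NM] sub[OF M TM MN])
  show ?thesis
    unfolding topology_eq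
    using openin_proj_closure_mono[OF N M T TN TM NM eq] openin_proj_closure_mono[OF M N T TM TN MN eq[symmetric]]
    by blast
qed

subsection \<open>Iterated partial derivatives\<close>

text \<open>Lists of directions match the definition of \<open>smooth_fns\<close> and let a
  derivative be prepended or moved. The factors \<open>inverse \<i>\<close> of \<open>D_op\<close>
  are split off, since only absolute values enter the norms.\<close>

definition pds :: "'n::finite list \<Rightarrow> (real^'n \<Rightarrow> complex) \<Rightarrow> real^'n \<Rightarrow> complex" where
  "pds js f = foldr partial_deriv js f"

lemma pds_Nil [simp]: "pds [] f = f"
  by (simp add: pds_def)

lemma pds_Cons: "pds (j # js) f = partial_deriv j (pds js f)"
  by (simp add: pds_def)

lemma eventually_line_in_open:
  assumes "open U" "x \<in> U"
  shows "\<forall>\<^sub>F t in nhds 0. x + t *\<^sub>R (e :: 'a::real_normed_vector) \<in> U"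
proof -
  have "open ((\<lambda>t. x + t *\<^sub>R e) -` U)"
    by (intro open_vimage assms continuous_intros)
  from eventually_nhds_in_open[OF this, of 0] show ?thesis using assms(2) by simp
qed

lemma partial_deriv_cong:
  assumes "open U" "\<And>x. x \<in> U \<Longrightarrow> f x = g x" "x \<in> U"
  shows "partial_deriv j f x = partial_deriv j g x"
  unfolding partial_deriv_def
proof (rule vector_derivative_cong_eq[OF _ refl refl UNIV_I])
  show "\<forall>\<^sub>F t in nhds 0. t \<in> UNIV \<longrightarrow> f (x + t *\<^sub>R axis j 1) = g (x + t *\<^sub>R axis j 1)"
    using eventually_line_in_open[OF assms(1,3), of "axis j 1"] by (rule eventually_mono) (simp add: assms(2))
qed

lemma pds_cong:
  assumes "open U" "\<And>x. x \<in> U \<Longrightarrow> f x = g x" "x \<in> U"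
  shows "pds js f x = pds js g x"
  using assms(3)
proof (induction js arbitrary: x)
  case (Cons j js)
  then show ?case using partial_deriv_cong[OF assms(1), of "pds js f" "pds js g"] by (simp add: pds_Cons)
qed (simp add: assms(2))

lemma pds_zero: "pds js (\<lambda>_. 0) x = 0"
proof (induction js arbitrary: x)
  case (Cons j js)
  then have "pds js (\<lambda>_. 0) = (\<lambda>_. 0)" by blast
  then show ?case by (simp only: pds_Cons) (simp add: partial_deriv_def)
qed simp

lemma pds_eq_zero_off_support:
  assumes "x \<notin> closure {x. f x \<noteq> 0}"
  shows "pds js f x = 0"
proof -
  have "pds js f x = pds js (\<lambda>_. 0) x"
  proof (rule pds_cong)
    show "open (- closure {x. f x \<noteq> 0})" by (simp add: open_Compl)
    show "f y = 0" if "y \<in> - closure {x. f x \<noteq> 0}" for y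
      using that closure_subset[of "{x. f x \<noteq> 0}"] by blast
  qed (use assms in simp)
  then show ?thesis by (simp add: pds_zero)
qed

lemma smooth_has_pds:
  assumes "f \<in> smooth_fns U" "x \<in> U"
  shows "((\<lambda>t. pds js f (x + t *\<^sub>R axis j 1)) has_vector_derivative pds (j # js) f x) (at 0)"
  unfolding pds_Cons partial_deriv_def vector_derivative_works[symmetric]
  using assms by (simp add: smooth_fns_def pds_def)

lemma smooth_continuous_on: "f \<in> smooth_fns U \<Longrightarrow> continuous_on U (pds js f)"
  by (simp add: smooth_fns_def pds_def)

lemma pds_lincomb:
  assumes "open U" "f \<in> smooth_fns U" "g \<in> smooth_fns U" "x \<in> U"
  shows "pds js (\<lambda>x. a * f x + b * g x) x = a * pds js f x + b * pds js g x"
  using assms(4)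
proof (induction js arbitrary: x)
  case (Cons j js)
  have "pds (j # js) (\<lambda>x. a * f x + b * g x) x = partial_deriv j (\<lambda>x. a * pds js f x + b * pds js g x) x"
    using partial_deriv_cong[OF assms(1) Cons.IH Cons.prems] by (simp add: pds_Cons)
  also have "\<dots> = a * pds (j # js) f x + b * pds (j # js) g x"
    unfolding partial_deriv_def[of j]
    by (intro vector_derivative_at has_vector_derivative_add has_vector_derivative_mult_right
        smooth_has_pds[OF assms(2) Cons.prems] smooth_has_pds[OF assms(3) Cons.prems])
  finally show ?case .
qed simp

lemma smooth_lincomb:
  assumes "open U" "f \<in> smooth_fns U" "g \<in> smooth_fns U"
  shows "(\<lambda>x. a * f x + b * g x) \<in> smooth_fns U"
  unfolding smooth_fns_def pds_def[symmetric]
proof (intro CollectI conjI allI ballI impI)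
  fix js
  have "continuous_on U (\<lambda>x. a * pds js f x + b * pds js g x)"
    using assms by (intro continuous_intros smooth_continuous_on)
  then show "continuous_on U (pds js (\<lambda>x. a * f x + b * g x))"
    by (rule continuous_on_eq) (simp add: pds_lincomb[OF assms])
  fix x j assume x: "x \<in> U"
  have "((\<lambda>t. a * pds js f (x + t *\<^sub>R axis j 1) + b * pds js g (x + t *\<^sub>R axis j 1))
      has_vector_derivative a * pds (j # js) f x + b * pds (j # js) g x) (at 0)"
    by (intro has_vector_derivative_add has_vector_derivative_mult_right
        smooth_has_pds[OF assms(2) x] smooth_has_pds[OF assms(3) x])
  then have "((\<lambda>t. pds js (\<lambda>x. a * f x + b * g x) (x + t *\<^sub>R axis j 1))
      has_vector_derivative a * pds (j # js) f x + b * pds (j # js) g x) (at 0)"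
    by (rule has_vector_derivative_cong_ev[THEN iffD1, rotated -1])
      (use eventually_line_in_open[OF assms(1) x, of "axis j 1"] in
        \<open>auto elim!: eventually_mono simp: pds_lincomb[OF assms] x\<close>)
  then show "(\<lambda>t. pds js (\<lambda>x. a * f x + b * g x) (x + t *\<^sub>R axis j 1)) differentiable at 0"
    by (rule differentiableI_vector)
qed (use assms in \<open>simp add: smooth_fns_def\<close>)

definition midx_list :: "('n::{finite,linorder} \<Rightarrow> nat) \<Rightarrow> 'n list" where
  "midx_list \<alpha> = concat (map (\<lambda>j. replicate (\<alpha> j) j) (sorted_list_of_set UNIV))"

text \<open>The function \<open>g\<close> agrees with a multiple of an iterated derivative on
  \<open>U\<close> only. This form lets the blocks of D^\<alpha> be stripped one after the other,
  with the powers of \<open>inverse \<i>\<close> collected in the constant.\<close>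

lemma D_op_power:
  assumes "open U" "f \<in> smooth_fns U" "\<And>x. x \<in> U \<Longrightarrow> g x = c * pds js f x" "x \<in> U"
  shows "(D_op j ^^ n) g x = inverse \<i> ^ n * c * pds (replicate n j @ js) f x"
  using assms(4)
proof (induction n arbitrary: x)
  case (Suc n)
  have "(D_op j ^^ Suc n) g x =
      inverse \<i> * partial_deriv j (\<lambda>x. inverse \<i> ^ n * c * pds (replicate n j @ js) f x) x"
    using partial_deriv_cong[OF assms(1), of "(D_op j ^^ n) g"
        "\<lambda>x. inverse \<i> ^ n * c * pds (replicate n j @ js) f x", OF Suc.IH Suc.prems]
    by (simp only: D_op_def funpow.simps o_apply)
  also have "partial_deriv j (\<lambda>x. inverse \<i> ^ n * c * pds (replicate n j @ js) f x) x =
      inverse \<i> ^ n * c * pds (j # replicate n j @ js) f x"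
    unfolding partial_deriv_def[of j]
    by (intro vector_derivative_at has_vector_derivative_mult_right smooth_has_pds[OF assms(2) Suc.prems])
  finally show ?case by (simp add: mult_ac)
qed (use assms in simp)

lemma cmod_D_multi:
  assumes "open U" "f \<in> smooth_fns U" "x \<in> U"
  shows "cmod (D_multi \<alpha> f x) = cmod (pds (midx_list \<alpha>) f x)"
proof -
  \<comment> \<open>The induction needs one constant for all points of \<open>U\<close>, because the
    next operator differentiates the identity.\<close>
  have "\<exists>c. cmod c = 1 \<and> (\<forall>x\<in>U. foldr (\<lambda>j. D_op j ^^ \<alpha> j) l f x =
      c * pds (concat (map (\<lambda>j. replicate (\<alpha> j) j) l)) f x)" for l
  proof (induction l)
    case Nil
    then show ?case by (intro exI[of _ 1]) simp
  next
    case (Cons j l)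
    then obtain c where c: "cmod c = 1" "\<And>x. x \<in> U \<Longrightarrow> foldr (\<lambda>j. D_op j ^^ \<alpha> j) l f x =
      c * pds (concat (map (\<lambda>j. replicate (\<alpha> j) j) l)) f x"
      by blast
    then show ?case
      using D_op_power[OF assms(1,2) c(2)]
      by (intro exI[of _ "inverse \<i> ^ \<alpha> j * c"])
        (auto simp: norm_mult norm_power norm_inverse)
  qed
  then obtain c where "cmod c = 1" "D_multi \<alpha> f x = c * pds (midx_list \<alpha>) f x"
    using assms(3) unfolding D_multi_def midx_list_def by blast
  then show ?thesis by (simp add: norm_mult)
qed

subsection \<open>Symmetry of mixed partial derivatives\<close>

text \<open>Smoothness speaks of the parameter 0 on each line; moving the base point along the line
  gives the derivative at every \<open>t0\<close>.\<close>

lemma smooth_UNIV_has_pds: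
  assumes "f \<in> smooth_fns UNIV"
  shows "((\<lambda>t. pds js f (x + t *\<^sub>R axis j 1)) has_vector_derivative pds (j # js) f (x + t0 *\<^sub>R axis j 1))
           (at t0 within S)"
proof -
  have "((\<lambda>t. t - t0) has_vector_derivative 1) (at t0)"
    by (auto intro!: derivative_eq_intros)
  moreover have "((\<lambda>t. pds js f ((x + t0 *\<^sub>R axis j 1) + t *\<^sub>R axis j 1)) has_vector_derivative
      pds (j # js) f (x + t0 *\<^sub>R axis j 1)) (at (t0 - t0))"
    using smooth_has_pds[OF assms, of "x + t0 *\<^sub>R axis j 1" js j] by simp
  ultimately have "((\<lambda>t. pds js f ((x + t0 *\<^sub>R axis j 1) + t *\<^sub>R axis j 1)) \<circ> (\<lambda>t. t - t0)
      has_vector_derivative 1 *\<^sub>R pds (j # js) f (x + t0 *\<^sub>R axis j 1)) (at t0)"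
    by (rule vector_diff_chain_at)
  then show ?thesis
    by (simp add: o_def scaleR_diff_left has_vector_derivative_at_within)
qed

lemma continuous_on_pds_compose:
  assumes "f \<in> smooth_fns UNIV" "continuous_on S g"
  shows "continuous_on S (\<lambda>x. pds js f (g x))"
  using continuous_on_compose2[OF smooth_continuous_on[OF assms(1)] assms(2)] by auto

text \<open>Both sides arise by differentiating $f(x + s e_i + t e_j) - f(x + t e_j) =
  \int_0^s \partial_i f(x + u e_i + t e_j)\,du$ in \<open>t\<close> at \<open>0\<close>, and then in \<open>s\<close> at \<open>0\<close>.\<close>
lemma pds_swap:
  assumes f: "f \<in> smooth_fns UNIV"
  shows "pds (i # j # js) f x = pds (j # i # js) f x"
proof -
  let ?p = "\<lambda>s t. x + s *\<^sub>R axis i 1 + t *\<^sub>R axis j 1"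
  have ftc: "integral (cbox 0 s) (\<lambda>u. pds (i # js) f (?p u t)) = pds js f (?p s t) - pds js f (?p 0 t)"
    if "0 \<le> s" for s t
  proof -
    have "((\<lambda>u. pds (i # js) f ((x + t *\<^sub>R axis j 1) + u *\<^sub>R axis i 1)) has_integral
        pds js f ((x + t *\<^sub>R axis j 1) + s *\<^sub>R axis i 1) - pds js f ((x + t *\<^sub>R axis j 1) + 0 *\<^sub>R axis i 1)) {0..s}"
      by (intro fundamental_theorem_of_calculus that smooth_UNIV_has_pds f)
    moreover have "(x + t *\<^sub>R axis j 1) + u *\<^sub>R axis i 1 = ?p u t" for u
      by (simp only: add.assoc add.commute[of "t *\<^sub>R axis j 1"])
    ultimately show ?thesis by (simp only: integral_unique cbox_interval)
  qed
  have eq: "pds (j # js) f (?p s 0) - pds (j # js) f x = integral {0..s} (\<lambda>u. pds (j # i # js) f (?p u 0))"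
    if s: "0 \<le> s" for s
  proof -
    have 1: "((\<lambda>t. integral (cbox 0 s) (\<lambda>u. pds (i # js) f (?p u t))) has_vector_derivative
        integral (cbox 0 s) (\<lambda>u. pds (j # i # js) f (?p u 0))) (at 0 within UNIV)"
    proof (rule leibniz_rule_vector_derivative)
      show "((\<lambda>t. pds (i # js) f (?p u t)) has_vector_derivative pds (j # i # js) f (?p u t)) (at t within UNIV)"
        for u t by (rule smooth_UNIV_has_pds[OF f])
      show "(\<lambda>u. pds (i # js) f (?p u t)) integrable_on cbox 0 s" for t
        by (intro integrable_continuous continuous_on_pds_compose f continuous_intros)
      show "continuous_on (UNIV \<times> cbox 0 s) (\<lambda>(t, u). pds (j # i # js) f (?p u t))"
        unfolding split_beta by (intro continuous_on_pds_compose f continuous_intros)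
    qed simp_all
    have 2: "((\<lambda>t. pds js f (?p s t) - pds js f (?p 0 t)) has_vector_derivative
        pds (j # js) f (?p s 0) - pds (j # js) f (?p 0 0)) (at 0 within UNIV)"
      by (intro has_vector_derivative_diff smooth_UNIV_has_pds f)
    show ?thesis
      using vector_derivative_unique_at[OF 2 1[unfolded ftc[OF s]]] by simp
  qed
  \<comment> \<open>The integral identity covers s \<ge> 0 only, so the outer derivative is
    one-sided. The filter at 0 within {0..1} is nontrivial, hence derivatives are still
    unique.\<close>
  have "((\<lambda>s. integral {0..s} (\<lambda>u. pds (j # i # js) f (?p u 0))) has_vector_derivative
      pds (j # i # js) f (?p 0 0)) (at 0 within {0..1})"
    by (intro integral_has_vector_derivative continuous_on_pds_compose f continuous_intros) simp
  then have "((\<lambda>s. integral {0..s} (\<lambda>u. pds (j # i # js) f (x + u *\<^sub>R axis i 1))) has_vector_derivative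
      pds (j # i # js) f x) (at 0 within {0..1})"
    by simp
  then have 1: "((\<lambda>s. pds (j # js) f (x + s *\<^sub>R axis i 1) - pds (j # js) f x) has_vector_derivative
      pds (j # i # js) f x) (at 0 within {0..1})"
    by (rule has_vector_derivative_transform[rotated 2]) (use eq in simp_all)
  have 2: "((\<lambda>s. pds (j # js) f (x + s *\<^sub>R axis i 1) - pds (j # js) f x) has_vector_derivative
      pds (i # j # js) f (x + 0 *\<^sub>R axis i 1) - 0) (at 0 within {0..1})"
    by (intro has_vector_derivative_diff smooth_UNIV_has_pds f has_vector_derivative_const)
  have "at 0 within {0..1::real} \<noteq> bot" by (simp add: trivial_limit_within islimpt_Icc)
  then show ?thesis
    using vector_derivative_unique_within[OF _ 2 1] by simp
qed

lemma pds_move: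
  assumes f: "f \<in> smooth_fns UNIV"
  shows "pds (xs @ j # ys) f = pds (j # xs @ ys) f"
proof (induction xs)
  case (Cons a xs)
  have "pds ((a # xs) @ j # ys) f = partial_deriv a (pds (xs @ j # ys) f)" by (simp add: pds_Cons)
  also have "\<dots> = pds (a # j # xs @ ys) f" by (simp add: Cons.IH pds_Cons)
  also have "\<dots> = pds (j # a # xs @ ys) f" by (rule ext) (rule pds_swap[OF f])
  finally show ?case by simp
qed simp

lemma pds_perm:
  assumes f: "f \<in> smooth_fns UNIV" and "mset js = mset ks"
  shows "pds js f = pds ks f"
  using assms(2)
proof (induction js arbitrary: ks)
  case (Cons j js)
  then have "j \<in> set ks" by (metis list.set_intros(1) mset_eq_setD)
  then obtain xs ys where ks: "ks = xs @ j # ys" by (meson split_list)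
  then have "pds js f = pds (xs @ ys) f" using Cons by simp
  then show ?case unfolding ks pds_move[OF f] by (simp add: pds_Cons)
qed simp

subsection \<open>A Sobolev inequality\<close>

text \<open>The fundamental theorem of calculus on a line that starts outside the support. The
  integrand is parametrised by the value \<open>t\<close> of the \<open>j\<close>-th coordinate,
  which fits the iteration over the coordinates.\<close>

lemma cmod_pds_le_line_integral:
  assumes f: "f \<in> smooth_fns UNIV" and supp: "bounded {x. f x \<noteq> 0}"
  shows "ennreal (cmod (pds js f x)) \<le>
    (\<integral>\<^sup>+t. ennreal (cmod (pds (j # js) f (x + (t - x $ j) *\<^sub>R axis j 1))) \<partial>lborel)"
proof -
  define c where "c = x $ j"
  let ?q = "\<lambda>t. (x - c *\<^sub>R axis j 1) + t *\<^sub>R axis j 1"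
  obtain R where R: "\<And>x. x \<in> closure {x. f x \<noteq> 0} \<Longrightarrow> norm x \<le> R"
    using bounded_closure[OF supp] unfolding bounded_iff by blast
  \<comment> \<open>Left of \<open>x $ j\<close>, as the integration requires, and so far out that a
    point with \<open>j\<close>-th coordinate \<open>a\<close> has norm above
    \<open>R\<close>.\<close>
  define a where "a = min c (- R - 1)"
  have "?q a $ j = a" by (simp add: c_def axis_def)
  then have "\<bar>a\<bar> \<le> norm (?q a)" by (metis component_le_norm_cart)
  then have "?q a \<notin> closure {x. f x \<noteq> 0}" using R[of "?q a"] unfolding a_def by linarith
  then have 0: "pds js f (?q a) = 0" by (rule pds_eq_zero_off_support)
  have cont: "continuous_on T (\<lambda>t. pds (j # js) f (?q t))" for T
    by (intro continuous_on_pds_compose f continuous_intros)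
  have "integral\<^sup>L lborel (\<lambda>t. indicator {a..c} t *\<^sub>R pds (j # js) f (?q t)) =
      pds js f (?q c) - pds js f (?q a)"
    by (intro integral_FTC_atLeastAtMost smooth_UNIV_has_pds f cont) (simp add: a_def)
  then have "ennreal (cmod (pds js f x)) =
      ennreal (norm (integral\<^sup>L lborel (\<lambda>t. indicator {a..c} t *\<^sub>R pds (j # js) f (?q t))))"
    using 0 by simp
  also have "\<dots> \<le> (\<integral>\<^sup>+t. norm (indicator {a..c} t *\<^sub>R pds (j # js) f (?q t)) \<partial>lborel)"
    using borel_integrable_atLeastAtMost'[OF cont] unfolding set_integrable_def
    by (rule integral_norm_bound_ennreal)
  also have "\<dots> \<le> (\<integral>\<^sup>+t. ennreal (cmod (pds (j # js) f (?q t))) \<partial>lborel)"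
    by (intro nn_integral_mono) (auto simp: indicator_def)
  also have "?q = (\<lambda>t. x + (t - x $ j) *\<^sub>R axis j 1)"
    by (simp add: c_def fun_eq_iff scaleR_diff_left)
  finally show ?thesis .
qed

text \<open>Induction over the coordinates: those in \<open>ls\<close> are integration variables,
  the others stay at their values in \<open>x\<close>. The product is indexed by basis vectors
  because \<open>lborel_eq\<close> represents Lebesgue measure in this way.\<close>

lemma cmod_pds_le_PiM_integral:
  fixes f :: "real^'n \<Rightarrow> complex"
  assumes f: "f \<in> smooth_fns UNIV" and supp: "bounded {x. f x \<noteq> 0}"
    and ls: "distinct ls"
  defines "e \<equiv> \<lambda>j::'n. axis j 1 :: real^'n"
  shows "ennreal (cmod (pds js f x)) \<le>
    (\<integral>\<^sup>+z. ennreal (cmod (pds (ls @ js) f (\<Sum>b\<in>Basis. (if b \<in> e ` set ls then z b else x \<bullet> b) *\<^sub>R b)))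
        \<partial>(\<Pi>\<^sub>M b\<in>e ` set ls. lborel))"
  using ls
proof (induction ls)
  case Nil
  then show ?case
    by (simp add: PiM_empty nn_integral_count_space_finite euclidean_representation)
next
  case (Cons i ls)
  interpret product_sigma_finite "\<lambda>_::real^'n. lborel :: real measure" ..
  let ?J = "e ` set ls"
  let ?P = "\<lambda>J z. \<Sum>b\<in>Basis. (if b \<in> J then z b else x \<bullet> b) *\<^sub>R b"
  have eB: "e i \<in> Basis" by (auto simp: e_def Basis_vec_def)
  have notin: "e i \<notin> ?J" using Cons.prems by (auto simp: e_def axis_eq_axis)
  \<comment> \<open>Turning coordinate \<open>i\<close> into a variable with value \<open>t\<close>
    means moving along axis \<open>i\<close> until that coordinate is \<open>t\<close>, exactly the
    point in \<open>cmod_pds_le_line_integral\<close>.\<close>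
  have upd: "?P (insert (e i) ?J) (z(e i := t)) = ?P ?J z + (t - ?P ?J z $ i) *\<^sub>R e i" for z t
  proof (rule euclidean_eqI)
    fix b :: "real^'n" assume b: "b \<in> Basis"
    have P: "?P J v \<bullet> c = (if c \<in> J then v c else x \<bullet> c)" if "c \<in> Basis" for J v c
      using that by (rule inner_sum_left_Basis)
    have "?P ?J z $ i = ?P ?J z \<bullet> e i" by (simp only: e_def cart_eq_inner_axis)
    then show "?P (insert (e i) ?J) (z(e i := t)) \<bullet> b = (?P ?J z + (t - ?P ?J z $ i) *\<^sub>R e i) \<bullet> b"
      unfolding inner_add_left inner_scaleR_left inner_Basis[OF eB b]
      using P[OF b] P[OF eB] notin by (cases "b = e i") (simp_all only:, simp_all)
  qed
  have meas: "(\<lambda>z. ennreal (cmod (pds ((i # ls) @ js) f (?P J z)))) \<in> borel_measurable (\<Pi>\<^sub>M b\<in>J. lborel)"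
    for J
  proof -
    have "(\<lambda>z. ?P J z) \<in> borel_measurable (\<Pi>\<^sub>M b\<in>J. lborel)"
    proof (intro borel_measurable_sum borel_measurable_scaleR borel_measurable_const)
      show "(\<lambda>z. if b \<in> J then z b else x \<bullet> b) \<in> borel_measurable (\<Pi>\<^sub>M b\<in>J. lborel)" for b
        using measurable_component_singleton[of b J "\<lambda>_. lborel"] by (cases "b \<in> J") auto
    qed
    moreover have "(\<lambda>y. ennreal (cmod (pds ((i # ls) @ js) f y))) \<in> borel_measurable borel"
      by (intro measurable_compose[OF _ measurable_ennreal] borel_measurable_continuous_onI
          continuous_on_norm smooth_continuous_on f)
    ultimately show ?thesis by (rule measurable_compose)
  qed
  have "ennreal (cmod (pds js f x)) \<le>
      (\<integral>\<^sup>+z. ennreal (cmod (pds (ls @ js) f (?P ?J z))) \<partial>(\<Pi>\<^sub>M b\<in>?J. lborel))"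
    using Cons by simp
  also have "\<dots> \<le> (\<integral>\<^sup>+z. (\<integral>\<^sup>+t. ennreal (cmod (pds ((i # ls) @ js) f (?P (insert (e i) ?J) (z(e i := t)))))
      \<partial>lborel) \<partial>(\<Pi>\<^sub>M b\<in>?J. lborel))"
    unfolding upd append_Cons
    by (rule nn_integral_mono, rule order_trans[OF cmod_pds_le_line_integral[OF f supp, of _ _ i]])
      (simp_all add: e_def)
  also have "\<dots> = (\<integral>\<^sup>+z. ennreal (cmod (pds ((i # ls) @ js) f (?P (insert (e i) ?J) z)))
      \<partial>(\<Pi>\<^sub>M b\<in>insert (e i) ?J. lborel))"
    by (rule product_nn_integral_insert[symmetric, OF _ notin meas]) simp
  finally show ?case by (simp only: list.set image_insert)
qed

text \<open>Once every coordinate is integrated, \<open>x\<close> has disappeared from the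
  right-hand side and the bound is uniform.\<close>

lemma cmod_pds_le_integral:
  fixes f :: "real^'n \<Rightarrow> complex"
  assumes f: "f \<in> smooth_fns UNIV" and supp: "bounded {x. f x \<noteq> 0}"
    and ls: "distinct ls" "set ls = UNIV"
  shows "ennreal (cmod (pds js f x)) \<le> (\<integral>\<^sup>+y. ennreal (cmod (pds (ls @ js) f y)) \<partial>lborel)"
proof -
  have B: "(\<lambda>j::'n. axis j 1) ` set ls = (Basis :: (real^'n) set)"
    by (simp only: ls(2) Basis_vec_def Basis_real_def) (simp add: UNION_singleton_eq_range)
  have "(\<Sum>b\<in>(Basis :: (real^'n) set). (if b \<in> Basis then z b else x \<bullet> b) *\<^sub>R b) = (\<Sum>b\<in>Basis. z b *\<^sub>R b)" for z
    by (rule sum.cong) simp_all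
  then have "ennreal (cmod (pds js f x)) \<le>
     (\<integral>\<^sup>+z. ennreal (cmod (pds (ls @ js) f (\<Sum>b\<in>Basis. z b *\<^sub>R b))) \<partial>(\<Pi>\<^sub>M b\<in>(Basis :: (real^'n) set). lborel))"
    using cmod_pds_le_PiM_integral[OF f supp ls(1), of js x] unfolding B by simp
  also have "\<dots> = (\<integral>\<^sup>+y. ennreal (cmod (pds (ls @ js) f y)) \<partial>lborel)"
    by (subst (2) lborel_eq, subst nn_integral_distr)
      (auto intro!: measurable_compose[OF _ measurable_ennreal] measurable_component_singleton borel_measurable_continuous_onI
          continuous_on_norm smooth_continuous_on f borel_measurable_sum borel_measurable_scaleR)
  finally show ?thesis .
qed

text \<open>The set where a continuous function exceeds \<open>c\<close> is open, and a nonempty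
  open set is not null.\<close>

lemma le_of_AE_le:
  fixes g :: "'a::euclidean_space \<Rightarrow> real"
  assumes U: "open U" and g: "continuous_on U g"
    and AE: "AE x in restrict_space lborel U. g x \<le> c" and x: "x \<in> U"
  shows "g x \<le> c"
proof (rule ccontr)
  assume c: "\<not> g x \<le> c"
  let ?V = "g -` {c<..} \<inter> U"
  have V: "open ?V"
    using g U by (simp add: continuous_on_open_vimage)
  have "AE x in lborel. x \<in> U \<longrightarrow> g x \<le> c"
    using AE U by (subst (asm) AE_restrict_space_iff) auto
  then have "AE x in lborel. x \<notin> ?V" by eventually_elim auto
  then have "?V \<in> null_sets lborel" using V by (simp add: AE_iff_null_sets)
  then have "negligible ?V" by (simp add: negligible_iff_null_sets null_sets_completionI)
  then have "?V = {}" using V open_not_negligible by blast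
  moreover have "x \<in> ?V" using x c by simp
  ultimately show False by blast
qed

lemma measurable_cmod_pds:
  assumes "f \<in> smooth_fns U"
  shows "(\<lambda>x. cmod (pds js f x)) \<in> borel_measurable (restrict_space lborel U)"
proof -
  have "(\<lambda>x. cmod (pds js f x)) \<in> borel_measurable (restrict_space borel U)"
    by (intro borel_measurable_continuous_on_restrict continuous_on_norm smooth_continuous_on assms)
  then show ?thesis
    by (simp cong: measurable_cong_sets add: sets_restrict_space_cong[OF sets_lborel])
qed

subsection \<open>The Gevrey norms\<close>

lemma ennpowr_le_iff:
  assumes "0 < a" "0 \<le> c"
  shows "ennpowr x (1 / a) \<le> ennreal c \<longleftrightarrow> x \<le> ennreal (c powr a)"
proof (cases x)
  case (real r)
  have "r powr (1 / a) \<le> c \<longleftrightarrow> r \<le> c powr a"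
    using powr_mono2[of a "r powr (1 / a)" c] powr_mono2[of "1 / a" r "c powr a"] assms real
    by (auto simp: powr_powr)
  then show ?thesis using real assms by (simp add: ennpowr_def ennreal_le_iff)
qed (simp add: ennpowr_def top_unique)

lemma ennpowr_ennreal: "0 \<le> c \<Longrightarrow> ennpowr (ennreal c) a = ennreal (c powr a)"
  by (simp add: ennpowr_def)

lemma ennpowr_mult_root:
  assumes "0 < a" "0 < c"
  shows "ennpowr (ennreal c * ennpowr x (1 / a)) a = ennreal (c powr a) * x"
proof (cases x)
  case (real r)
  have "ennreal c * ennpowr x (1 / a) = ennreal (c * r powr (1 / a))"
    using real assms by (simp add: ennpowr_ennreal ennreal_mult)
  then have "ennpowr (ennreal c * ennpowr x (1 / a)) a = ennreal ((c * r powr (1 / a)) powr a)"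
    using assms ennpowr_ennreal[of "c * r powr (1 / a)" a] by simp
  also have "\<dots> = ennreal (c powr a) * x"
    using real assms by (simp add: powr_mult powr_powr ennreal_mult)
  finally show ?thesis .
qed (use assms in \<open>simp add: ennpowr_def ennreal_mult_top\<close>)

lemma ennreal_mult_le_iff:
  assumes "0 < w" "0 \<le> c"
  shows "ennreal w * y \<le> ennreal c \<longleftrightarrow> y \<le> ennreal (c / w)"
  using assms
  by (cases y) (auto simp: ennreal_mult_top top_unique pos_le_divide_eq mult.commute simp flip: ennreal_mult)

definition weight :: "real \<Rightarrow> real \<Rightarrow> ('n::finite \<Rightarrow> nat) \<Rightarrow> real" where
  "weight s h \<alpha> = h ^ midx_abs \<alpha> / midx_fact \<alpha> powr s"

lemma midx_fact_pos: "midx_fact \<alpha> > 0"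
  by (simp add: midx_fact_def prod_pos)

lemma weight_pos: "0 < h \<Longrightarrow> 0 < weight s h \<alpha>"
  using midx_fact_pos[of \<alpha>] by (simp add: weight_def)

text \<open>The \<open>p\<close>-th power of the \<open>L\<^sup>p\<close> norm; comparing powers
  avoids roots of extended numbers.\<close>

definition pow_integral :: "real \<Rightarrow> (real^'n::finite) set \<Rightarrow> (real^'n \<Rightarrow> complex) \<Rightarrow> ennreal" where
  "pow_integral p U g = (\<integral>\<^sup>+x. ennreal (cmod (g x) powr p) \<partial>restrict_space lborel U)"

lemma pow_integral_cong:
  "(\<And>x. x \<in> U \<Longrightarrow> cmod (f x) = cmod (g x)) \<Longrightarrow> pow_integral p U f = pow_integral p U g"
  unfolding pow_integral_def by (intro nn_integral_cong) (simp add: space_restrict_space)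

text \<open>Derivatives are continuous on the open set \<open>U\<close>, so essential bounds are
  pointwise bounds.\<close>

lemma gevrey_norm_infinity_le_iff:
  fixes f :: "real^'n::{finite,linorder} \<Rightarrow> complex"
  assumes U: "open U" and f: "f \<in> smooth_fns U" and h: "0 < h" and c: "0 \<le> c"
  shows "gevrey_norm s \<infinity> h U f \<le> ennreal c \<longleftrightarrow>
    (\<forall>\<alpha>. \<forall>x\<in>U. weight s h \<alpha> * cmod (pds (midx_list \<alpha>) f x) \<le> c)"
proof -
  have "ennreal (weight s h \<alpha>) * Lp_norm \<infinity> U (D_multi \<alpha> f) \<le> ennreal c \<longleftrightarrow>
    (\<forall>x\<in>U. weight s h \<alpha> * cmod (pds (midx_list \<alpha>) f x) \<le> c)" for \<alpha> :: "'n \<Rightarrow> nat"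
  proof -
    let ?M = "restrict_space lborel U"
    let ?g = "\<lambda>x. cmod (pds (midx_list \<alpha>) f x)"
    have w: "0 < weight s h \<alpha>" by (rule weight_pos[OF h])
    have meas: "(\<lambda>x. ennreal (?g x)) \<in> borel_measurable ?M"
      using measurable_cmod_pds[OF f] by simp
    have L: "Lp_norm \<infinity> U (D_multi \<alpha> f) = esssup ?M (\<lambda>x. ennreal (?g x))"
    proof -
      have "(\<lambda>x. ennreal (cmod (D_multi \<alpha> f x))) \<in> borel_measurable ?M"
        using meas by (rule measurable_cong[THEN iffD1, rotated])
          (simp add: space_restrict_space cmod_D_multi[OF U f])
      then show ?thesis
        unfolding Lp_norm_def
        by (simp, intro esssup_AE_cong meas AE_I2) (simp_all add: space_restrict_space cmod_D_multi[OF U f])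
    qed
    have "esssup ?M (\<lambda>x. ennreal (?g x)) \<le> ennreal d \<longleftrightarrow> (\<forall>x\<in>U. ?g x \<le> d)" if d: "0 \<le> d" for d
    proof
      assume le: "esssup ?M (\<lambda>x. ennreal (?g x)) \<le> ennreal d"
      have "AE x in ?M. ?g x \<le> d"
        using esssup_AE[where M = ?M and f = "\<lambda>x. ennreal (?g x)"]
      proof eventually_elim
        case (elim x)
        then have "ennreal (?g x) \<le> ennreal d" using le by (rule order_trans)
        then show ?case using d by (simp add: ennreal_le_iff)
      qed
      then show "\<forall>x\<in>U. ?g x \<le> d"
        using le_of_AE_le[OF U continuous_on_norm[OF smooth_continuous_on[OF f]]] by blast
    next
      assume le: "\<forall>x\<in>U. ?g x \<le> d"
      show "esssup ?M (\<lambda>x. ennreal (?g x)) \<le> ennreal d"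
        by (intro esssup_I meas AE_I2) (use le in \<open>simp add: space_restrict_space ennreal_leI\<close>)
    qed
    from this[of "c / weight s h \<alpha>"]
    have "esssup ?M (\<lambda>x. ennreal (?g x)) \<le> ennreal (c / weight s h \<alpha>) \<longleftrightarrow>
        (\<forall>x\<in>U. weight s h \<alpha> * ?g x \<le> c)"
      using w c by (simp add: pos_le_divide_eq mult.commute)
    then show ?thesis unfolding L ennreal_mult_le_iff[OF w c] .
  qed
  then show ?thesis
    using f unfolding gevrey_norm_def weight_def[symmetric] by (simp add: SUP_le_iff)
qed

text \<open>An infinite sum of nonnegative terms is the supremum of its finite partial sums, and the
  outer root moves to the other side as a power of \<open>c\<close>. Later estimates thus deal with
  finite sums only.\<close>

lemma gevrey_norm_le_iff:
  fixes f :: "real^'n::{finite,linorder} \<Rightarrow> complex"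
  assumes U: "open U" and f: "f \<in> smooth_fns U" and h: "0 < h" and c: "0 \<le> c"
    and p: "1 \<le> p" "p < \<infinity>"
  shows "gevrey_norm s p h U f \<le> ennreal c \<longleftrightarrow>
    (\<forall>F. finite F \<longrightarrow> (\<Sum>\<alpha>\<in>F. ennreal (weight s h \<alpha> powr enn2real p) * pow_integral (enn2real p) U (pds (midx_list \<alpha>) f))
       \<le> ennreal (c powr enn2real p))"
proof -
  let ?p = "enn2real p"
  have p1: "1 \<le> ?p" using p by (cases p) auto
  have pinf: "p \<noteq> \<infinity>" using p by auto
  have "ennpowr (ennreal (weight s h \<alpha>) * Lp_norm p U (D_multi \<alpha> f)) ?p =
    ennreal (weight s h \<alpha> powr ?p) * pow_integral ?p U (pds (midx_list \<alpha>) f)" for \<alpha> :: "'n \<Rightarrow> nat"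
  proof -
    have "pow_integral ?p U (D_multi \<alpha> f) = pow_integral ?p U (pds (midx_list \<alpha>) f)"
      by (rule pow_integral_cong) (rule cmod_D_multi[OF U f])
    then have "Lp_norm p U (D_multi \<alpha> f) = ennpowr (pow_integral ?p U (pds (midx_list \<alpha>) f)) (1 / ?p)"
      using pinf by (simp add: Lp_norm_def pow_integral_def)
    then show ?thesis
      using p1 by (simp only:) (intro ennpowr_mult_root weight_pos h, simp)
  qed
  then have "gevrey_norm s p h U f = ennpowr (\<Sum>\<^sub>\<infinity>\<alpha>. ennreal (weight s h \<alpha> powr ?p) *
      pow_integral ?p U (pds (midx_list \<alpha>) f)) (1 / ?p)"
    using f pinf unfolding gevrey_norm_def weight_def[symmetric] by simp
  moreover have "0 < ?p" using p1 by simp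
  ultimately show ?thesis
    using c by (simp add: ennpowr_le_iff nonneg_infsum_complete SUP_le_iff)
qed

section \<open>The triangle inequality and the norm axioms\<close>

text \<open>Convexity of t^p at x/a and y/b with weights a/(a+b) and b/(a+b), multiplied by (a+b)^p.
  In the application \<open>a\<close> and \<open>b\<close> are bounds of the two norms.\<close>

lemma powr_convex_bound:
  fixes x y :: real
  assumes p: "1 \<le> p" and a: "0 < a" "0 < b" and x: "0 \<le> x" "0 \<le> y"
  shows "(x + y) powr p \<le> (a + b) powr p * (a / (a + b) / a powr p) * x powr p +
           (a + b) powr p * (b / (a + b) / b powr p) * y powr p"
proof -
  let ?u = "a / (a + b)" and ?v = "b / (a + b)"
  have v: "?u + ?v = 1" "0 < ?u" "0 < ?v" "?u \<le> 1" "?v \<le> 1"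
    using a by (simp_all flip: add_divide_distrib)
  \<comment> \<open>Handles a vanishing summand; convexity is invoked at positive arguments
    only.\<close>
  have sm: "(t * z) powr p \<le> t * z powr p" if "0 < t" "t \<le> 1" "0 \<le> z" for t z :: real
  proof -
    have "t powr p \<le> t" using powr_mono'[of 1 p t] that p by simp
    then show ?thesis using that by (simp add: powr_mult mult_right_mono)
  qed
  have cv: "(?u * x' + ?v * y') powr p \<le> ?u * x' powr p + ?v * y' powr p"
    if x': "0 \<le> x'" and y': "0 \<le> y'" for x' y' :: real
  proof -
    consider "x' = 0" | "y' = 0" | "0 < x'" "0 < y'" using x' y' by linarith
    then show ?thesis
    proof cases
      case 3
      have "?u = 1 - ?v" using v by linarith
      then show ?thesis
        using convex_onD[OF powr_convex[OF p], of ?v x' y'] v 3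
        unfolding \<open>?u = 1 - ?v\<close> by simp
    qed (use sm[of ?u x'] sm[of ?v y'] v x' y' p in auto)
  qed
  have "(x + y) powr p = (a + b) powr p * (?u * (x / a) + ?v * (y / b)) powr p"
  proof -
    have "?u * (x / a) = x / (a + b)" "?v * (y / b) = y / (a + b)"
      using a by simp_all
    then have "x + y = (a + b) * (?u * (x / a) + ?v * (y / b))"
      using a by (simp flip: add_divide_distrib)
    then show ?thesis using a x by (simp add: powr_mult)
  qed
  also have "\<dots> \<le> (a + b) powr p * (?u * (x / a) powr p + ?v * (y / b) powr p)"
    using cv[of "x / a" "y / b"] a x by (intro mult_left_mono) auto
  also have "\<dots> = (a + b) powr p * (?u / a powr p) * x powr p + (a + b) powr p * (?v / b powr p) * y powr p"
    using a x by (simp add: powr_divide algebra_simps)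
  finally show ?thesis .
qed

text \<open>Minkowski's inequality for the mixed $\ell^p(L^p)$ norm: its unit ball is convex because
  $t \mapsto t^p$ is, and the other balls are multiples of it.\<close>
lemma gevrey_norm_add_le_finite:
  fixes f g :: "real^'n::{finite,linorder} \<Rightarrow> complex"
  assumes U: "open U" and f: "f \<in> smooth_fns U" and g: "g \<in> smooth_fns U" and h: "0 < h"
    and p: "1 \<le> p" "p < \<infinity>" and a: "0 < a" "0 < b"
    and le: "gevrey_norm s p h U f \<le> ennreal a" "gevrey_norm s p h U g \<le> ennreal b"
  shows "gevrey_norm s p h U (\<lambda>x. f x + g x) \<le> ennreal (a + b)"
proof -
  let ?p = "enn2real p"
  have p1: "1 \<le> ?p" using p by (cases p) auto
  \<comment> \<open>Chosen so that ?A * a^p + ?B * b^p = (a + b)^p, because the two weights add up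
    to 1.\<close>
  let ?A = "(a + b) powr ?p * (a / (a + b) / a powr ?p)" and ?B = "(a + b) powr ?p * (b / (a + b) / b powr ?p)"
  have fg: "(\<lambda>x. f x + g x) \<in> smooth_fns U"
    using smooth_lincomb[OF U f g, of 1 1] by simp
  have AB: "0 \<le> ?A" "0 \<le> ?B" using a by simp_all
  have I: "pow_integral ?p U (pds js (\<lambda>x. f x + g x)) \<le>
      ennreal ?A * pow_integral ?p U (pds js f) + ennreal ?B * pow_integral ?p U (pds js g)" for js
  proof -
    have [measurable]: "(\<lambda>x. cmod (pds js f x)) \<in> borel_measurable (restrict_space lborel U)"
      "(\<lambda>x. cmod (pds js g x)) \<in> borel_measurable (restrict_space lborel U)"
      by (intro measurable_cmod_pds f g)+
    have "ennreal (cmod (pds js (\<lambda>x. f x + g x) x) powr ?p) \<le>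
        ennreal ?A * ennreal (cmod (pds js f x) powr ?p) + ennreal ?B * ennreal (cmod (pds js g x) powr ?p)"
      if x: "x \<in> U" for x
    proof -
      have "pds js (\<lambda>x. f x + g x) x = pds js f x + pds js g x"
        using pds_lincomb[OF U f g x, of js 1 1] by simp
      then have "cmod (pds js (\<lambda>x. f x + g x) x) powr ?p \<le> (cmod (pds js f x) + cmod (pds js g x)) powr ?p"
        using p1 by (intro powr_mono2) (simp_all add: norm_triangle_ineq)
      also have "\<dots> \<le> ?A * cmod (pds js f x) powr ?p + ?B * cmod (pds js g x) powr ?p"
        by (rule powr_convex_bound[OF p1 a]) simp_all
      finally have "ennreal (cmod (pds js (\<lambda>x. f x + g x) x) powr ?p) \<le>
          ennreal (?A * cmod (pds js f x) powr ?p + ?B * cmod (pds js g x) powr ?p)"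
        by (rule ennreal_leI)
      also have "\<dots> = ennreal ?A * ennreal (cmod (pds js f x) powr ?p) + ennreal ?B * ennreal (cmod (pds js g x) powr ?p)"
        using AB by (simp add: ennreal_plus ennreal_mult del: times_divide_eq_right)
      finally show ?thesis .
    qed
    then have "pow_integral ?p U (pds js (\<lambda>x. f x + g x)) \<le>
       (\<integral>\<^sup>+x. ennreal ?A * ennreal (cmod (pds js f x) powr ?p) + ennreal ?B * ennreal (cmod (pds js g x) powr ?p)
          \<partial>restrict_space lborel U)"
      unfolding pow_integral_def by (intro nn_integral_mono) (simp add: space_restrict_space)
    also have "\<dots> = ennreal ?A * pow_integral ?p U (pds js f) + ennreal ?B * pow_integral ?p U (pds js g)"
      unfolding pow_integral_def by (simp add: nn_integral_add nn_integral_cmult)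
    finally show ?thesis .
  qed
  let ?S = "\<lambda>F f. \<Sum>\<alpha>\<in>F. ennreal (weight s h \<alpha> powr ?p) * pow_integral ?p U (pds (midx_list \<alpha>) f)"
  have "?S F (\<lambda>x. f x + g x) \<le> ennreal ((a + b) powr ?p)" if F: "finite F" for F
  proof -
    have "?S F (\<lambda>x. f x + g x) \<le> (\<Sum>\<alpha>\<in>F. ennreal (weight s h \<alpha> powr ?p) *
        (ennreal ?A * pow_integral ?p U (pds (midx_list \<alpha>) f) + ennreal ?B * pow_integral ?p U (pds (midx_list \<alpha>) g)))"
      by (intro sum_mono mult_left_mono I) simp
    also have "\<dots> = ennreal ?A * ?S F f + ennreal ?B * ?S F g"
      by (simp only: sum_distrib_left sum.distrib distrib_left mult.left_commute)
    also have "\<dots> \<le> ennreal ?A * ennreal (a powr ?p) + ennreal ?B * ennreal (b powr ?p)"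
      using le F a p1 unfolding gevrey_norm_le_iff[OF U f h less_imp_le[OF a(1)] p]
        gevrey_norm_le_iff[OF U g h less_imp_le[OF a(2)] p]
      by (intro add_mono mult_left_mono) auto
    also have "\<dots> = ennreal (?A * a powr ?p + ?B * b powr ?p)"
      using AB by (simp add: ennreal_plus ennreal_mult del: times_divide_eq_right)
    also have "?A * a powr ?p + ?B * b powr ?p = (a + b) powr ?p"
      using a by (simp flip: distrib_left add_divide_distrib)
    finally show ?thesis .
  qed
  then show ?thesis
    using a by (subst gevrey_norm_le_iff[OF U fg h _ p]) auto
qed

lemma gevrey_norm_smooth: "gevrey_norm s p h U f < \<infinity> \<Longrightarrow> f \<in> smooth_fns U"
  by (auto simp: gevrey_norm_def split: if_splits)

lemma gevrey_norm_add:
  fixes f g :: "real^'n::{finite,linorder} \<Rightarrow> complex"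
  assumes U: "open U" and h: "0 < h" and p: "1 \<le> p"
  shows "gevrey_norm s p h U (\<lambda>x. f x + g x) \<le> gevrey_norm s p h U f + gevrey_norm s p h U g"
proof (rule ennreal_le_epsilon)
  fix e :: real
  assume fin: "gevrey_norm s p h U f + gevrey_norm s p h U g < top" and e: "0 < e"
  then obtain a b where a: "0 \<le> a" "gevrey_norm s p h U f = ennreal a"
    and b: "0 \<le> b" "gevrey_norm s p h U g = ennreal b"
    by (cases "gevrey_norm s p h U f"; cases "gevrey_norm s p h U g") auto
  have f: "f \<in> smooth_fns U" and g: "g \<in> smooth_fns U"
    using a b by (auto intro!: gevrey_norm_smooth[of s p h])
  have fg: "(\<lambda>x. f x + g x) \<in> smooth_fns U"
    using smooth_lincomb[OF U f g, of 1 1] by simp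
  \<comment> \<open>The norms \<open>a\<close> and \<open>b\<close> may be zero, while the convexity
    argument divides by its bounds; the slack \<open>e / 2\<close> makes both positive.\<close>
  have "gevrey_norm s p h U (\<lambda>x. f x + g x) \<le> ennreal ((a + e / 2) + (b + e / 2))"
  proof (cases "p = \<infinity>")
    case False
    then show ?thesis
      using a b e p by (intro gevrey_norm_add_le_finite U f g h) (auto simp: less_top intro!: ennreal_leI)
  next
    case True
    have "weight s h \<alpha> * cmod (pds (midx_list \<alpha>) (\<lambda>x. f x + g x) x) \<le> a + b" if x: "x \<in> U" for \<alpha> x
    proof -
      have "weight s h \<alpha> * cmod (pds (midx_list \<alpha>) (\<lambda>x. f x + g x) x) \<le>
          weight s h \<alpha> * (cmod (pds (midx_list \<alpha>) f x) + cmod (pds (midx_list \<alpha>) g x))"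
        using weight_pos[OF h, of s \<alpha>] pds_lincomb[OF U f g x, of "midx_list \<alpha>" 1 1]
        by (intro mult_left_mono) (simp_all add: norm_triangle_ineq)
      also have "\<dots> \<le> a + b"
      proof -
        have "gevrey_norm s \<infinity> h U f \<le> ennreal a" "gevrey_norm s \<infinity> h U g \<le> ennreal b"
          using a b True by simp_all
        then show ?thesis
          unfolding gevrey_norm_infinity_le_iff[OF U f h a(1)] gevrey_norm_infinity_le_iff[OF U g h b(1)] distrib_left
          using x by (intro add_mono) blast+
      qed
      finally show ?thesis .
    qed
    then have "gevrey_norm s p h U (\<lambda>x. f x + g x) \<le> ennreal (a + b)"
      unfolding True using a b by (subst gevrey_norm_infinity_le_iff[OF U fg h]) simp_all
    also have "\<dots> \<le> ennreal ((a + e / 2) + (b + e / 2))"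
      using e by (intro ennreal_leI) simp
    finally show ?thesis .
  qed
  also have "\<dots> = gevrey_norm s p h U f + gevrey_norm s p h U g + ennreal e"
    using a b e by (simp flip: ennreal_plus)
  finally show "gevrey_norm s p h U (\<lambda>x. f x + g x) \<le> gevrey_norm s p h U f + gevrey_norm s p h U g + ennreal e" .
qed

lemma ennreal_le_of_real_bounds:
  fixes x y :: ennreal
  assumes "\<And>c. 0 \<le> c \<Longrightarrow> x \<le> ennreal c \<Longrightarrow> y \<le> ennreal c"
  shows "y \<le> x"
  using assms by (cases x) auto

lemma gevrey_norm_minus_le:
  fixes f :: "real^'n::{finite,linorder} \<Rightarrow> complex"
  assumes U: "open U" and h: "0 < h" and p: "1 \<le> p"
  shows "gevrey_norm s p h U (\<lambda>x. - f x) \<le> gevrey_norm s p h U f"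
proof (rule ennreal_le_of_real_bounds)
  fix c :: real
  assume c: "0 \<le> c" and le: "gevrey_norm s p h U f \<le> ennreal c"
  have f: "f \<in> smooth_fns U"
    using le by (intro gevrey_norm_smooth[of s p h]) (simp add: le_less_trans[OF _ ennreal_less_top])
  have f': "(\<lambda>x. - f x) \<in> smooth_fns U"
    using smooth_lincomb[OF U f f, of "-1" 0] by simp
  have eq: "cmod (pds js (\<lambda>x. - f x) x) = cmod (pds js f x)" if "x \<in> U" for js x
    using pds_lincomb[OF U f f that, of js "-1" 0] by simp
  show "gevrey_norm s p h U (\<lambda>x. - f x) \<le> ennreal c"
  proof (cases "p = \<infinity>")
    case True
    then show ?thesis
      using le eq unfolding True gevrey_norm_infinity_le_iff[OF U f h c] gevrey_norm_infinity_le_iff[OF U f' h c]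
      by simp
  next
    case False
    then have p': "p < \<infinity>" by (simp add: less_top)
    have "pow_integral q U (pds js (\<lambda>x. - f x)) = pow_integral q U (pds js f)" for q js
      by (intro pow_integral_cong eq)
    then show ?thesis
      using le unfolding gevrey_norm_le_iff[OF U f h c p p'] gevrey_norm_le_iff[OF U f' h c p p'] by simp
  qed
qed

lemma zero_smooth: "(\<lambda>_. 0) \<in> smooth_fns (U :: (real^'n::finite) set)"
proof -
  have "foldr partial_deriv js (\<lambda>_. 0) = (\<lambda>_. 0)" for js :: "'n list"
    using pds_zero[of js] by (simp add: pds_def fun_eq_iff)
  then show ?thesis by (simp add: smooth_fns_def)
qed

lemma ext_norm_gevrey:
  fixes U :: "(real^'n::{finite,linorder}) set"
  assumes U: "open U" and h: "0 < h" and p: "1 \<le> p"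
  shows "ext_norm (gevrey_norm s p h U)"
proof
  fix f g :: "real^'n::{finite,linorder} \<Rightarrow> complex"
  show "gevrey_norm s p h U (\<lambda>x. f x + g x) \<le> gevrey_norm s p h U f + gevrey_norm s p h U g"
    by (rule gevrey_norm_add[OF U h p])
  show "gevrey_norm s p h U (\<lambda>x. - f x) = gevrey_norm s p h U f"
    using gevrey_norm_minus_le[OF U h p, of s f] gevrey_norm_minus_le[OF U h p, of s "\<lambda>x. - f x"] by simp
  have "gevrey_norm s p h U (\<lambda>_. 0) \<le> ennreal 0"
  proof (cases "p = \<infinity>")
    case True
    then show ?thesis
      by (simp only: gevrey_norm_infinity_le_iff[OF U zero_smooth h order_refl] pds_zero) simp
  next
    case False
    then have "p < \<infinity>" by (simp add: less_top)
    moreover from this have "0 < enn2real p" using p by (cases p) auto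
    ultimately show ?thesis
      by (simp only: gevrey_norm_le_iff[OF U zero_smooth h order_refl p] pow_integral_def pds_zero) simp
  qed
  then show "gevrey_norm s p h U (\<lambda>_. 0) = 0" by simp
  assume "gevrey_norm s p h U f = 0"
  then have le: "gevrey_norm s p h U f \<le> ennreal 0" by simp
  have f: "f \<in> smooth_fns U"
    using le by (intro gevrey_norm_smooth[of s p h]) simp
  \<comment> \<open>Definiteness comes from the term \<alpha> = 0 alone: it is \<open>f\<close>
    itself with weight 1. Outside \<open>U\<close> the function vanishes by the chosen
    representation.\<close>
  have w: "weight s h (\<lambda>_::'n. 0) = 1" and l: "midx_list (\<lambda>_. 0) = []"
    by (simp_all add: weight_def midx_abs_def midx_fact_def midx_list_def)
  have "cmod (f x) \<le> 0" if x: "x \<in> U" for x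
  proof (cases "p = \<infinity>")
    case True
    then have "weight s h (\<lambda>_::'n. 0) * cmod (pds (midx_list (\<lambda>_. 0)) f x) \<le> 0"
      using gevrey_norm_infinity_le_iff[THEN iffD1, OF U f h order_refl le[unfolded True]] x by blast
    then show ?thesis by (simp add: w l)
  next
    case False
    then have p': "p < \<infinity>" by (simp add: less_top)
    then have p1: "0 < enn2real p" using p by (cases p) auto
    have "pow_integral (enn2real p) U f \<le> 0"
      using le[unfolded gevrey_norm_le_iff[OF U f h order_refl p p'], rule_format, of "{\<lambda>_::'n. 0}"] p1
      by (simp add: w l)
    then have "(\<integral>\<^sup>+x. ennreal (cmod (f x) powr enn2real p) \<partial>restrict_space lborel U) = 0"
      by (simp add: pow_integral_def)
    then have "AE x in restrict_space lborel U. ennreal (cmod (f x) powr enn2real p) = 0"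
      using measurable_cmod_pds[OF f, of "[]"] by (subst (asm) nn_integral_0_iff_AE) auto
    then have "AE x in restrict_space lborel U. cmod (f x) \<le> 0"
      by eventually_elim (simp add: ennreal_eq_0_iff)
    then show ?thesis
      using le_of_AE_le[OF U continuous_on_norm[OF smooth_continuous_on[OF f, of "[]"]], of 0 x] x by simp
  qed
  moreover have "f x = 0" if "x \<notin> U" for x
    using f that by (simp add: smooth_fns_def)
  ultimately show "f = (\<lambda>_. 0)" by (auto simp: fun_eq_iff)
qed

lemma weight_mono: "0 < h \<Longrightarrow> h \<le> h' \<Longrightarrow> weight s h \<alpha> \<le> weight s h' \<alpha>"
  using midx_fact_pos[of \<alpha>] by (simp add: weight_def divide_right_mono power_mono)

lemma gevrey_norm_mono:
  fixes f :: "real^'n::{finite,linorder} \<Rightarrow> complex"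
  assumes U: "open U" and h: "0 < h" "h \<le> h'" and p: "1 \<le> p"
  shows "gevrey_norm s p h U f \<le> gevrey_norm s p h' U f"
proof (rule ennreal_le_of_real_bounds)
  fix c :: real
  assume c: "0 \<le> c" and le: "gevrey_norm s p h' U f \<le> ennreal c"
  have h': "0 < h'" using h by simp
  have f: "f \<in> smooth_fns U"
    using le by (intro gevrey_norm_smooth[of s p h']) (simp add: le_less_trans[OF _ ennreal_less_top])
  show "gevrey_norm s p h U f \<le> ennreal c"
  proof (cases "p = \<infinity>")
    case True
    have "weight s h \<alpha> * cmod (pds (midx_list \<alpha>) f x) \<le> weight s h' \<alpha> * cmod (pds (midx_list \<alpha>) f x)"
      for x and \<alpha> :: "'n \<Rightarrow> nat"
      by (intro mult_right_mono weight_mono h) simp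
    then show ?thesis
      using le unfolding True gevrey_norm_infinity_le_iff[OF U f h' c] gevrey_norm_infinity_le_iff[OF U f h(1) c]
      by (meson order_trans)
  next
    case False
    then have p': "p < \<infinity>" by (simp add: less_top)
    have "(\<Sum>\<alpha>\<in>F. ennreal (weight s h \<alpha> powr enn2real p) * pow_integral (enn2real p) U (pds (midx_list \<alpha>) f))
       \<le> (\<Sum>\<alpha>\<in>F. ennreal (weight s h' \<alpha> powr enn2real p) * pow_integral (enn2real p) U (pds (midx_list \<alpha>) f))" for F
      using weight_pos[OF h(1), THEN less_imp_le] weight_mono[OF h]
      by (intro sum_mono mult_right_mono ennreal_leI powr_mono2) auto
    then show ?thesis
      using le unfolding gevrey_norm_le_iff[OF U f h(1) c p p'] gevrey_norm_le_iff[OF U f h' c p p']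
      by (blast intro: order_trans)
  qed
qed

lemma ext_norm_family_gevrey:
  assumes "open U" "1 \<le> p"
  shows "ext_norm_family (\<lambda>h. gevrey_norm s p h U)"
  using assms by (intro ext_norm_family.intro ext_norm_gevrey gevrey_norm_mono)

subsection \<open>From the supremum norm to the \<open>L\<^sup>p\<close> norm\<close>

text \<open>A finite set of multi-indices fits into a cube, over which the sum factors into one
  geometric sum per coordinate.\<close>

lemma sum_power_midx_abs_le:
  fixes q :: real and F :: "('n::finite \<Rightarrow> nat) set"
  assumes q: "0 \<le> q" "q < 1" and F: "finite F"
  shows "(\<Sum>\<alpha>\<in>F. q ^ midx_abs \<alpha>) \<le> (1 / (1 - q)) ^ CARD('n)"
proof -
  define m where "m = Max (insert 0 (midx_abs ` F))"
  have "F \<subseteq> PiE (UNIV :: 'n set) (\<lambda>_. {..m})"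
  proof
    fix \<alpha> assume \<alpha>: "\<alpha> \<in> F"
    have "\<alpha> j \<le> m" for j
    proof -
      have "\<alpha> j \<le> midx_abs \<alpha>" unfolding midx_abs_def by (rule member_le_sum) simp_all
      also have "\<dots> \<le> m" unfolding m_def using \<alpha> F by (intro Max_ge) auto
      finally show ?thesis .
    qed
    then show "\<alpha> \<in> PiE (UNIV :: 'n set) (\<lambda>_. {..m})" by (simp add: PiE_UNIV_domain)
  qed
  then have "(\<Sum>\<alpha>\<in>F. q ^ midx_abs \<alpha>) \<le> (\<Sum>\<alpha>\<in>PiE (UNIV :: 'n set) (\<lambda>_. {..m}). q ^ midx_abs \<alpha>)"
    using q by (intro sum_mono2 finite_PiE) simp_all
  also have "\<dots> = (\<Prod>j\<in>(UNIV :: 'n set). \<Sum>k\<le>m. q ^ k)"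
    unfolding midx_abs_def power_sum by (rule prod_sum_PiE[symmetric]) simp_all
  also have "\<dots> \<le> (1 / (1 - q)) ^ CARD('n)"
  proof -
    have "(\<Sum>k\<le>m. q ^ k) \<le> 1 / (1 - q)"
      using q sum_le_suminf[of "\<lambda>k. q ^ k" "{..m}"] by (simp add: suminf_geometric summable_geometric)
    then show ?thesis using q by (simp add: power_mono sum_nonneg)
  qed
  finally show ?thesis .
qed

lemma pow_integral_le:
  fixes U :: "(real^'n::finite) set"
  assumes U: "open U" "bounded U" and p: "0 < p" and c: "\<And>x. x \<in> U \<Longrightarrow> cmod (g x) \<le> c" "0 \<le> c"
  shows "pow_integral p U g \<le> ennreal (c powr p * measure lborel U)"
proof -
  have "pow_integral p U g \<le> (\<integral>\<^sup>+x. ennreal (c powr p) \<partial>restrict_space lborel U)"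
    unfolding pow_integral_def using c p
    by (intro nn_integral_mono ennreal_leI powr_mono2) (simp_all add: space_restrict_space)
  also have "\<dots> = ennreal (c powr p) * emeasure lborel U"
    using U by (simp add: emeasure_restrict_space space_restrict_space)
  also have "emeasure lborel U = ennreal (measure lborel U)"
    using U emeasure_bounded_finite[of U] by (intro emeasure_eq_ennreal_measure) auto
  finally show ?thesis by (simp add: ennreal_mult)
qed

lemma gevrey_norm_le_infinity:
  fixes U :: "(real^'n::{finite,linorder}) set"
  assumes U: "open U" "bounded U" and p: "1 \<le> p" "p < \<infinity>" and h: "0 < h" "h < h1"
  shows "\<exists>K>0. \<forall>f. gevrey_norm s p h U f \<le> ennreal K * gevrey_norm s \<infinity> h1 U f"
proof -
  let ?p = "enn2real p"
  have p1: "1 \<le> ?p" using p by (cases p) auto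
  have h1: "0 < h1" using h by simp
  define q where "q = (h / h1) powr ?p"
  have q: "0 \<le> q" "q < 1"
    using h h1 p1 powr_less_mono2[of ?p "h / h1" 1] by (simp_all add: q_def)
  \<comment> \<open>Bounds the sum of the \<open>p\<close>-th powers for supremum norm 1: |U| for
    each integral, times the geometric series in all coordinates.\<close>
  define S where "S = (1 / (1 - q)) ^ CARD('n) * measure lborel U"
  \<comment> \<open>The summand 1 keeps \<open>K\<close> positive when \<open>U\<close> is
    empty.\<close>
  define K where "K = S powr (1 / ?p) + 1"
  have S: "0 \<le> S" using q by (simp add: S_def)
  have K: "0 < K" by (simp add: K_def add_nonneg_pos)
  have SK: "S \<le> K powr ?p"
  proof -
    have "S = (S powr (1 / ?p)) powr ?p" using S p1 by (simp add: powr_powr)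
    also have "\<dots> \<le> K powr ?p" using p1 by (intro powr_mono2) (simp_all add: K_def)
    finally show ?thesis .
  qed
  have "gevrey_norm s p h U f \<le> ennreal K * gevrey_norm s \<infinity> h1 U f" for f
  proof (cases "gevrey_norm s \<infinity> h1 U f")
    case top
    then show ?thesis using K by (simp add: ennreal_mult_top)
  next
    case (real c)
    then have f: "f \<in> smooth_fns U" by (intro gevrey_norm_smooth[of s \<infinity> h1]) simp
    have c: "weight s h1 \<alpha> * cmod (pds (midx_list \<alpha>) f x) \<le> c" if "x \<in> U" for \<alpha> x
      using gevrey_norm_infinity_le_iff[THEN iffD1, OF U(1) f h1 real(1)] real(2) that by simp
    have each: "ennreal (weight s h \<alpha> powr ?p) * pow_integral ?p U (pds (midx_list \<alpha>) f) \<le>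
        ennreal (c powr ?p * measure lborel U * q ^ midx_abs \<alpha>)" for \<alpha>
    proof -
      have w: "0 < weight s h1 \<alpha>" "0 < weight s h \<alpha>" using h h1 by (simp_all add: weight_pos)
      have "pow_integral ?p U (pds (midx_list \<alpha>) f) \<le> ennreal ((c / weight s h1 \<alpha>) powr ?p * measure lborel U)"
        using c[of _ \<alpha>] w p1 real(1) by (intro pow_integral_le U) (simp_all add: pos_le_divide_eq mult.commute)
      then have "ennreal (weight s h \<alpha> powr ?p) * pow_integral ?p U (pds (midx_list \<alpha>) f) \<le>
          ennreal (weight s h \<alpha> powr ?p) * ennreal ((c / weight s h1 \<alpha>) powr ?p * measure lborel U)"
        by (rule mult_left_mono) simp
      also have "\<dots> = ennreal (weight s h \<alpha> powr ?p * ((c / weight s h1 \<alpha>) powr ?p * measure lborel U))"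
        by (simp add: ennreal_mult)
      also have "weight s h \<alpha> powr ?p * ((c / weight s h1 \<alpha>) powr ?p * measure lborel U) =
          c powr ?p * measure lborel U * (weight s h \<alpha> / weight s h1 \<alpha>) powr ?p"
        using w real(1) by (simp add: powr_divide)
      \<comment> \<open>The factorials cancel, leaving the geometric decay that makes the sum
        converge.\<close>
      also have "weight s h \<alpha> / weight s h1 \<alpha> = (h / h1) ^ midx_abs \<alpha>"
        using midx_fact_pos[of \<alpha>] by (simp add: weight_def power_divide)
      also have "((h / h1) ^ midx_abs \<alpha>) powr ?p = q ^ midx_abs \<alpha>"
        unfolding q_def using h h1 by (simp add: powr_power powr_realpow[symmetric] powr_powr mult.commute)
      finally show ?thesis .
    qed
    have "(\<Sum>\<alpha>\<in>F. ennreal (weight s h \<alpha> powr ?p) * pow_integral ?p U (pds (midx_list \<alpha>) f))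
       \<le> ennreal ((K * c) powr ?p)" if F: "finite F" for F
    proof -
      have "(\<Sum>\<alpha>\<in>F. ennreal (weight s h \<alpha> powr ?p) * pow_integral ?p U (pds (midx_list \<alpha>) f))
        \<le> (\<Sum>\<alpha>\<in>F. ennreal (c powr ?p * measure lborel U * q ^ midx_abs \<alpha>))"
        by (intro sum_mono each)
      also have "\<dots> = ennreal (c powr ?p * measure lborel U * (\<Sum>\<alpha>\<in>F. q ^ midx_abs \<alpha>))"
        using q by (simp add: sum_ennreal sum_distrib_left)
      also have "\<dots> \<le> ennreal (c powr ?p * S)"
        unfolding S_def using sum_power_midx_abs_le[OF q F]
        by (intro ennreal_leI) (simp add: mult_left_mono mult.assoc mult.commute[of "measure lborel U"] mult_right_mono)
      also have "\<dots> \<le> ennreal ((K * c) powr ?p)"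
        using SK K real(1) by (intro ennreal_leI) (simp add: powr_mult mult.commute mult_right_mono)
      finally show ?thesis .
    qed
    then have "gevrey_norm s p h U f \<le> ennreal (K * c)"
      using K real(1) by (subst gevrey_norm_le_iff[OF U(1) f h(1) _ p]) auto
    then show ?thesis using K real by (simp add: ennreal_mult)
  qed
  then show ?thesis using K by blast
qed

subsection \<open>Test functions\<close>

lemma test_fns_smooth: "f \<in> test_fns s U \<Longrightarrow> f \<in> smooth_fns U"
  by (simp add: test_fns_def)

text \<open>\<open>U\<close> and the complement of the support are open and cover the space; on the
  latter all derivatives vanish. Global smoothness is needed because the lines of integration leave
  \<open>U\<close>.\<close>

lemma test_fns_smooth_UNIV:
  fixes U :: "(real^'n::{finite,linorder}) set"
  assumes U: "open U" and f: "f \<in> test_fns s U"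
  shows "f \<in> smooth_fns UNIV"
  unfolding smooth_fns_def pds_def[symmetric]
proof (intro CollectI conjI allI ballI impI)
  let ?K = "closure {x. f x \<noteq> 0}"
  have fs: "f \<in> smooth_fns U" and K: "?K \<subseteq> U" "open (- ?K)"
    using f by (simp_all add: test_fns_def open_Compl)
  fix js
  have "continuous_on (U \<union> - ?K) (pds js f)"
  proof (rule continuous_on_open_Un)
    show "continuous_on (- ?K) (pds js f)"
      by (rule continuous_on_eq[OF continuous_on_const[of _ 0]]) (simp add: pds_eq_zero_off_support)
  qed (use U K fs in \<open>simp_all add: smooth_continuous_on\<close>)
  moreover have "U \<union> - ?K = UNIV" using K by blast
  ultimately show "continuous_on UNIV (pds js f)" by simp
  fix x j
  show "(\<lambda>t. pds js f (x + t *\<^sub>R axis j 1)) differentiable at 0"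
  proof (cases "x \<in> U")
    case True
    then show ?thesis using smooth_has_pds[OF fs True] by (rule_tac differentiableI_vector)
  next
    case False
    then have x: "x \<in> - ?K" using K by blast
    have "\<forall>\<^sub>F t in nhds 0. 0 = pds js f (x + t *\<^sub>R axis j 1)"
      using eventually_line_in_open[OF K(2) x, of "axis j 1"]
      by (rule eventually_mono) (simp add: pds_eq_zero_off_support)
    then have "((\<lambda>t. pds js f (x + t *\<^sub>R axis j 1)) has_vector_derivative 0) (at 0)"
      by (subst has_vector_derivative_cong_ev[where g = "\<lambda>_. 0", OF eventually_mono])
        (auto simp: pds_eq_zero_off_support x[simplified])
    then show ?thesis by (rule differentiableI_vector)
  qed
qed simp

lemma test_fns_support:
  "f \<in> test_fns s U \<Longrightarrow> x \<notin> U \<Longrightarrow> pds js f x = 0"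
  by (rule pds_eq_zero_off_support) (simp add: test_fns_def subset_iff, blast)

lemma test_fns_bounded_support: "f \<in> test_fns s U \<Longrightarrow> bounded {x. f x \<noteq> 0}"
  by (rule bounded_subset[OF compact_imp_bounded closure_subset]) (simp add: test_fns_def)

lemma test_fns_bound:
  fixes U :: "(real^'n::{finite,linorder}) set"
  assumes U: "open U" and f: "f \<in> test_fns s U" and k: "0 < k"
  shows "\<exists>B\<ge>0. \<forall>\<alpha>. \<forall>x\<in>U. cmod (pds (midx_list \<alpha>) f x) / (k ^ midx_abs \<alpha> * midx_fact \<alpha> powr s) \<le> B"
proof -
  obtain B where B: "\<And>\<alpha> x. x \<in> U \<Longrightarrow> cmod (D_multi \<alpha> f x) / (k ^ midx_abs \<alpha> * midx_fact \<alpha> powr s) \<le> B"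
  proof -
    have "bdd_above {cmod (D_multi \<alpha> f x) / (k ^ midx_abs \<alpha> * midx_fact \<alpha> powr s) | \<alpha> x. x \<in> U}"
      using f k by (simp add: test_fns_def)
    then show ?thesis using that unfolding bdd_above_def by blast
  qed
  show ?thesis
  proof (intro exI[of _ "max B 0"] conjI allI ballI)
    fix \<alpha> x assume x: "x \<in> U"
    show "cmod (pds (midx_list \<alpha>) f x) / (k ^ midx_abs \<alpha> * midx_fact \<alpha> powr s) \<le> max B 0"
      using B[OF x, of \<alpha>] by (simp add: cmod_D_multi[OF U test_fns_smooth[OF f] x])
  qed simp
qed

lemma test_fns_diff:
  fixes U :: "(real^'n::{finite,linorder}) set"
  assumes U: "open U" and f: "f \<in> test_fns s U" and g: "g \<in> test_fns s U"
  shows "(\<lambda>x. f x - g x) \<in> test_fns s U"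
proof -
  have fg: "f \<in> smooth_fns U" "g \<in> smooth_fns U" using f g by (simp_all add: test_fns_smooth)
  have s: "(\<lambda>x. f x - g x) \<in> smooth_fns U"
    using smooth_lincomb[OF U fg, of 1 "-1"] by simp
  let ?K = "closure {x. f x \<noteq> 0} \<union> closure {x. g x \<noteq> 0}"
  have "{x. f x - g x \<noteq> 0} \<subseteq> {x. f x \<noteq> 0} \<union> {x. g x \<noteq> 0}" by auto
  then have sub: "closure {x. f x - g x \<noteq> 0} \<subseteq> ?K"
    unfolding closure_Un[symmetric] by (rule closure_mono)
  have K: "compact ?K" "?K \<subseteq> U" using f g by (simp_all add: test_fns_def compact_Un)
  have "compact (?K \<inter> closure {x. f x - g x \<noteq> 0})"
    by (intro compact_Int_closed K closed_closure)
  then have "compact (closure {x. f x - g x \<noteq> 0})"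
    using sub by (simp add: Int_absorb1)
  moreover have "closure {x. f x - g x \<noteq> 0} \<subseteq> U" using sub K(2) by (rule order_trans)
  moreover have "bdd_above {cmod (D_multi \<alpha> (\<lambda>x. f x - g x) x) / (k ^ midx_abs \<alpha> * midx_fact \<alpha> powr s) | \<alpha> x. x \<in> U}"
    if k: "0 < k" for k
  proof -
    obtain A where A: "\<And>\<alpha> x. x \<in> U \<Longrightarrow> cmod (pds (midx_list \<alpha>) f x) / (k ^ midx_abs \<alpha> * midx_fact \<alpha> powr s) \<le> A"
      using test_fns_bound[OF U f k] by blast
    obtain B where B: "\<And>\<alpha> x. x \<in> U \<Longrightarrow> cmod (pds (midx_list \<alpha>) g x) / (k ^ midx_abs \<alpha> * midx_fact \<alpha> powr s) \<le> B"
      using test_fns_bound[OF U g k] by blast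
    have "cmod (D_multi \<alpha> (\<lambda>x. f x - g x) x) / (k ^ midx_abs \<alpha> * midx_fact \<alpha> powr s) \<le> A + B" if x: "x \<in> U" for \<alpha> x
    proof -
      have "cmod (D_multi \<alpha> (\<lambda>x. f x - g x) x) \<le> cmod (pds (midx_list \<alpha>) f x) + cmod (pds (midx_list \<alpha>) g x)"
        using pds_lincomb[OF U fg x, of "midx_list \<alpha>" 1 "-1"] norm_triangle_ineq4
        by (simp add: cmod_D_multi[OF U s x])
      then have "cmod (D_multi \<alpha> (\<lambda>x. f x - g x) x) / (k ^ midx_abs \<alpha> * midx_fact \<alpha> powr s) \<le>
         (cmod (pds (midx_list \<alpha>) f x) + cmod (pds (midx_list \<alpha>) g x)) / (k ^ midx_abs \<alpha> * midx_fact \<alpha> powr s)"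
        using k by (intro divide_right_mono) simp_all
      also have "\<dots> \<le> A + B" unfolding add_divide_distrib by (intro add_mono A B x)
      finally show ?thesis .
    qed
    then show ?thesis by (intro bdd_aboveI[of _ "A + B"]) blast
  qed
  ultimately show ?thesis using s by (simp add: test_fns_def)
qed

lemma test_fns_gevrey_norm_infinity:
  fixes U :: "(real^'n::{finite,linorder}) set"
  assumes U: "open U" and h: "0 < h" and f: "f \<in> test_fns s U"
  shows "gevrey_norm s \<infinity> h U f < \<infinity>"
proof -
  \<comment> \<open>The choice k = 1/h turns division by k^|\<alpha>| into the factor h^|\<alpha>|
    of the weight.\<close>
  have "0 < 1 / h" using h by simp
  from test_fns_bound[OF U f this] obtain B where B: "0 \<le> B"
    "\<And>\<alpha> x. x \<in> U \<Longrightarrow> cmod (pds (midx_list \<alpha>) f x) / ((1 / h) ^ midx_abs \<alpha> * midx_fact \<alpha> powr s) \<le> B"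
    by blast
  have "weight s h \<alpha> * cmod (pds (midx_list \<alpha>) f x) \<le> B" if "x \<in> U" for \<alpha> x
    using B(2)[OF that, of \<alpha>] h by (simp add: weight_def power_one_over field_simps)
  then have "gevrey_norm s \<infinity> h U f \<le> ennreal B"
    using gevrey_norm_infinity_le_iff[OF U test_fns_smooth[OF f] h B(1)] by blast
  then show ?thesis by (simp add: le_less_trans[OF _ ennreal_less_top])
qed

lemma test_fns_gevrey_norm:
  fixes U :: "(real^'n::{finite,linorder}) set"
  assumes U: "open U" "bounded U" and p: "1 \<le> p" "p < \<infinity>" and h: "0 < h" and f: "f \<in> test_fns s U"
  shows "gevrey_norm s p h U f < \<infinity>"
proof -
  have "h < h + 1" by simp
  from gevrey_norm_le_infinity[OF U p h this, of s] obtain K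
    where "gevrey_norm s p h U f \<le> ennreal K * gevrey_norm s \<infinity> (h + 1) U f" by blast
  moreover have "ennreal K * gevrey_norm s \<infinity> (h + 1) U f < \<infinity>"
    using test_fns_gevrey_norm_infinity[OF U(1) _ f, of "h + 1"] h by (simp add: ennreal_mult_less_top)
  ultimately show ?thesis by (rule le_less_trans)
qed

subsection \<open>From the \<open>L\<^sup>p\<close> norm to the supremum norm\<close>

text \<open>The order rises by \<open>CARD('n)\<close>. That many powers of
  \<open>2 powr s * h\<close> remain as a constant, while the other powers of
  \<open>2 powr s\<close> pay for the growth of the factorials through n + 1 \<le> 2^n.\<close>

lemma weight_Suc:
  fixes \<alpha> :: "'n::finite \<Rightarrow> nat"
  assumes h: "0 < h" and s: "0 \<le> s"
  shows "weight s h \<alpha> * (2 powr s * h) ^ CARD('n) \<le> weight s (2 powr s * h) (\<lambda>j. Suc (\<alpha> j))"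
proof -
  let ?P = "\<Prod>j\<in>UNIV. real (Suc (\<alpha> j))" and ?H = "2 powr s * h"
  have P: "0 < ?P" by (intro prod_pos) simp
  have "?P \<le> (\<Prod>j\<in>UNIV. 2 ^ \<alpha> j)"
  proof (rule prod_mono, safe)
    show "real (Suc (\<alpha> j)) \<le> 2 ^ \<alpha> j" for j
      using less_exp[of "\<alpha> j"] by (metis Suc_leI of_nat_le_iff of_nat_numeral of_nat_power)
  qed simp
  also have "\<dots> = 2 ^ midx_abs \<alpha>" by (simp add: midx_abs_def power_sum)
  finally have "?P powr s \<le> (2 ^ midx_abs \<alpha>) powr s" using P s by (intro powr_mono2) simp_all
  also have "\<dots> = (2 powr s) ^ midx_abs \<alpha>"
    by (simp add: powr_powr powr_realpow[symmetric] mult.commute)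
  finally have le: "?P powr s \<le> (2 powr s) ^ midx_abs \<alpha>" .
  have abs: "midx_abs (\<lambda>j. Suc (\<alpha> j)) = midx_abs \<alpha> + CARD('n)"
    by (simp add: midx_abs_def sum_Suc)
  have fact: "midx_fact (\<lambda>j. Suc (\<alpha> j)) = midx_fact \<alpha> * ?P"
    by (simp add: midx_fact_def mult.commute flip: prod.distrib)
  have F: "0 < midx_fact \<alpha> powr s" using midx_fact_pos[of \<alpha>] by simp
  have "weight s h \<alpha> * ?H ^ CARD('n) = h ^ midx_abs \<alpha> * ?H ^ CARD('n) / midx_fact \<alpha> powr s * 1"
    by (simp add: weight_def)
  also have "\<dots> \<le> h ^ midx_abs \<alpha> * ?H ^ CARD('n) / midx_fact \<alpha> powr s * ((2 powr s) ^ midx_abs \<alpha> / ?P powr s)"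
    using le P F h by (intro mult_left_mono) simp_all
  also have "\<dots> = weight s ?H (\<lambda>j. Suc (\<alpha> j))"
    using P midx_fact_pos[of \<alpha>] unfolding weight_def abs fact
    by (simp add: power_add power_mult_distrib powr_mult)
  finally show ?thesis .
qed

text \<open>The sorted list inserts each new direction into its block, whereas the Sobolev
  inequality puts all of them in front; \<open>pds_perm\<close> needs only equal multisets.\<close>

lemma mset_midx_list_Suc:
  fixes \<alpha> :: "'n::{finite,linorder} \<Rightarrow> nat"
  shows "mset (midx_list (\<lambda>j. Suc (\<alpha> j))) = mset (sorted_list_of_set UNIV @ midx_list \<alpha>)"
proof -
  have "mset (concat (map (\<lambda>j. replicate (Suc (\<alpha> j)) j) l)) =
      mset (l @ concat (map (\<lambda>j. replicate (\<alpha> j) j) l))" for l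
    by (induction l) simp_all
  then show ?thesis by (simp only: midx_list_def)
qed

text \<open>Integrating the following bound replaces Hoelder's inequality:
  \<open>v \<le> c + c powr (1 - p) * v powr p\<close>.\<close>
lemma integral_le_of_pow_integral:
  fixes U :: "(real^'n::finite) set"
  assumes U: "open U" "bounded U" and p: "1 \<le> p" and c: "0 < c"
    and g: "(\<lambda>x. cmod (g x)) \<in> borel_measurable (restrict_space lborel U)"
    and le: "pow_integral p U g \<le> ennreal (c powr p)"
  shows "(\<integral>\<^sup>+x. ennreal (cmod (g x)) \<partial>restrict_space lborel U) \<le> ennreal (c * (measure lborel U + 1))"
proof -
  have [measurable]: "(\<lambda>x. cmod (g x)) \<in> borel_measurable (restrict_space lborel U)" by (rule g)
  have M: "emeasure lborel U = ennreal (measure lborel U)"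
    using U emeasure_bounded_finite[of U] by (intro emeasure_eq_ennreal_measure) auto
  have "v \<le> c + c powr (1 - p) * v powr p" if "0 \<le> v" for v
  proof (cases "v \<le> c")
    case True
    then show ?thesis by (simp add: add_increasing2)
  next
    case False
    then have v: "c < v" by simp
    have "v = v powr (1 - p) * v powr p" using v c by (simp flip: powr_add)
    also have "\<dots> \<le> c powr (1 - p) * v powr p"
      using v c p by (intro mult_right_mono powr_mono2') simp_all
    finally show ?thesis using c by simp
  qed
  then have "(\<integral>\<^sup>+x. ennreal (cmod (g x)) \<partial>restrict_space lborel U) \<le>
      (\<integral>\<^sup>+x. ennreal (c + c powr (1 - p) * cmod (g x) powr p) \<partial>restrict_space lborel U)"
    by (intro nn_integral_mono ennreal_leI) simp
  also have "\<dots> = (\<integral>\<^sup>+x. ennreal c + ennreal (c powr (1 - p)) * ennreal (cmod (g x) powr p) \<partial>restrict_space lborel U)"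
    using c by (intro nn_integral_cong) (simp add: ennreal_plus ennreal_mult)
  also have "\<dots> = ennreal c * emeasure lborel U + ennreal (c powr (1 - p)) * pow_integral p U g"
    using U by (simp add: pow_integral_def nn_integral_add nn_integral_cmult emeasure_restrict_space space_restrict_space)
  also have "\<dots> \<le> ennreal c * ennreal (measure lborel U) + ennreal (c powr (1 - p)) * ennreal (c powr p)"
    unfolding M using le by (intro add_left_mono mult_left_mono) simp_all
  also have "\<dots> = ennreal (c * (measure lborel U + 1))"
    using c by (simp add: distrib_left flip: ennreal_mult ennreal_plus powr_add)
  finally show ?thesis .
qed

lemma gevrey_norm_pow_integral_le:
  fixes U :: "(real^'n::{finite,linorder}) set"
  assumes U: "open U" and p: "1 \<le> p" "p < \<infinity>" and h: "0 < h" and c: "0 \<le> c"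
    and le: "gevrey_norm s p h U f \<le> ennreal c"
  shows "pow_integral (enn2real p) U (pds (midx_list \<alpha>) f) \<le> ennreal ((c / weight s h \<alpha>) powr enn2real p)"
proof -
  have f: "f \<in> smooth_fns U"
    using le by (intro gevrey_norm_smooth[of s p h]) (simp add: le_less_trans[OF _ ennreal_less_top])
  have w: "0 < weight s h \<alpha>" using h by (rule weight_pos)
  have "ennreal (weight s h \<alpha> powr enn2real p) * pow_integral (enn2real p) U (pds (midx_list \<alpha>) f)
      \<le> ennreal (c powr enn2real p)"
    using le[unfolded gevrey_norm_le_iff[OF U f h c p], rule_format, of "{\<alpha>}"] by simp
  then show ?thesis using w c by (simp add: ennreal_mult_le_iff powr_divide)
qed

lemma test_fns_sup_le:
  fixes U :: "(real^'n::{finite,linorder}) set"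
  assumes U: "open U" "bounded U" and p: "1 \<le> p" "p < \<infinity>" and h: "0 < h" and s: "0 \<le> s"
    and f: "f \<in> test_fns s U" and c: "0 < c" and le: "gevrey_norm s p (2 powr s * h) U f \<le> ennreal c"
    and x: "x \<in> U"
  shows "weight s h \<alpha> * cmod (pds (midx_list \<alpha>) f x) \<le> (measure lborel U + 1) / (2 powr s * h) ^ CARD('n) * c"
proof -
  let ?\<alpha> = "\<lambda>j. Suc (\<alpha> j)" and ?H = "2 powr s * h"
  let ?g = "pds (midx_list ?\<alpha>) f"
  have p1: "1 \<le> enn2real p" using p by (cases p) auto
  have H: "0 < ?H" using h by simp
  have fU: "f \<in> smooth_fns UNIV" by (rule test_fns_smooth_UNIV[OF U(1) f])
  have W: "0 < weight s ?H ?\<alpha>" using H by (rule weight_pos)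
  have "ennreal (cmod (pds (midx_list \<alpha>) f x)) \<le>
      (\<integral>\<^sup>+y. ennreal (cmod (pds (sorted_list_of_set UNIV @ midx_list \<alpha>) f y)) \<partial>lborel)"
    by (rule cmod_pds_le_integral[OF fU test_fns_bounded_support[OF f]]) simp_all
  also have "pds (sorted_list_of_set UNIV @ midx_list \<alpha>) f = ?g"
    by (rule pds_perm[OF fU mset_midx_list_Suc[symmetric]])
  \<comment> \<open>The derivatives of a test function vanish off \<open>U\<close>, so the
    whole-space integral sees only the domain of the norm.\<close>
  also have "(\<integral>\<^sup>+y. ennreal (cmod (?g y)) \<partial>lborel) = (\<integral>\<^sup>+y. ennreal (cmod (?g y)) \<partial>restrict_space lborel U)"
    using U test_fns_support[OF f]
    by (subst nn_integral_restrict_space) (auto intro!: nn_integral_cong simp: indicator_def)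
  \<comment> \<open>A single term of the norm bounds the \<open>L\<^sup>p\<close> norm of
    \<open>?g\<close> by \<open>c / weight s ?H ?\<alpha>\<close>, the constant to which the
    substitute for Hoelder's inequality is applied.\<close>
  also have "\<dots> \<le> ennreal (c / weight s ?H ?\<alpha> * (measure lborel U + 1))"
    using c W by (intro integral_le_of_pow_integral[OF U p1] measurable_cmod_pds test_fns_smooth[OF f]
        gevrey_norm_pow_integral_le[OF U(1) p H _ le]) simp_all
  finally have "cmod (pds (midx_list \<alpha>) f x) \<le> c / weight s ?H ?\<alpha> * (measure lborel U + 1)"
    using c W by (simp add: ennreal_le_iff)
  then have "weight s h \<alpha> * cmod (pds (midx_list \<alpha>) f x) \<le>
      weight s h \<alpha> * (c / weight s ?H ?\<alpha> * (measure lborel U + 1))"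
    using weight_pos[OF h, of s \<alpha>] by (intro mult_left_mono) simp_all
  also have "\<dots> = (weight s h \<alpha> / weight s ?H ?\<alpha>) * (c * (measure lborel U + 1))" by simp
  also have "\<dots> \<le> (1 / ?H ^ CARD('n)) * (c * (measure lborel U + 1))"
  proof (rule mult_right_mono)
    show "weight s h \<alpha> / weight s ?H ?\<alpha> \<le> 1 / ?H ^ CARD('n)"
      using weight_Suc[OF h s, of \<alpha>] W H by (simp add: divide_le_eq le_divide_eq)
  qed (use c in simp)
  finally show ?thesis by (simp add: mult.commute)
qed

text \<open>The derivatives of the approximating test functions are bounded uniformly and converge in
  \<open>L\<^sup>p\<close>, so the set where a derivative of the limit exceeds the bound by \<open>d\<close> is null.\<close>
lemma norm_closure_sup_le:
  fixes U :: "(real^'n::{finite,linorder}) set"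
  assumes U: "open U" "bounded U" and p: "1 \<le> p" "p < \<infinity>" and h: "0 < h" and s: "0 \<le> s"
    and f: "f \<in> norm_closure (gevrey_norm s p (2 powr s * h) U) (test_fns s U)"
    and r: "0 \<le> r" "gevrey_norm s p (2 powr s * h) U f = ennreal r"
    and K: "K = (measure lborel U + 1) / (2 powr s * h) ^ CARD('n)" and x: "x \<in> U"
  shows "weight s h \<alpha> * cmod (pds (midx_list \<alpha>) f x) \<le> K * r"
proof (rule field_le_epsilon)
  fix d :: real assume d: "0 < d"
  let ?H = "2 powr s * h" and ?p = "enn2real p"
  let ?l = "midx_list \<alpha>" and ?w = "weight s h \<alpha>" and ?W = "weight s (2 powr s * h) \<alpha>"
  let ?A = "{y \<in> U. K * r + d < ?w * cmod (pds ?l f y)}"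
  have H: "0 < ?H" using h by simp
  interpret ext_norm "gevrey_norm s p ?H U" by (rule ext_norm_gevrey[OF U(1) H p(1)])
  have p1: "1 \<le> ?p" using p by (cases p) auto
  have w: "0 < ?w" "0 < ?W" using h H by (simp_all add: weight_pos)
  have "0 < measure lborel U + 1" by (simp add: add_nonneg_pos)
  then have Kpos: "0 < K" using H by (simp add: K)
  have fs: "f \<in> smooth_fns U" using r by (intro gevrey_norm_smooth[of s p ?H]) simp
  have cont: "continuous_on U (\<lambda>y. ?w * cmod (pds ?l f y))"
    by (intro continuous_intros smooth_continuous_on fs)
  have "?A = (\<lambda>y. ?w * cmod (pds ?l f y)) -` {K * r + d<..} \<inter> U" by auto
  then have A: "open ?A" using cont U(1) by (simp add: continuous_on_open_vimage)
  have fin: "emeasure lborel ?A < \<infinity>"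
    by (rule emeasure_bounded_finite) (rule bounded_subset[OF U(2)], blast)
  \<comment> \<open>The quotient of the \<open>L\<^sup>p\<close> bound \<open>e / ?W\<close> for the
    derivative of \<open>f - g\<close> and its lower bound \<open>d / (2 * ?w)\<close> on
    \<open>?A\<close>, without the factor \<open>e\<close>.\<close>
  define C where "C = 2 * ?w / (d * ?W)"
  have C: "0 < C" using d w by (simp add: C_def)
  have small: "emeasure lborel ?A \<le> ennreal ((C * e) powr ?p)" if e: "0 < e" "K * e \<le> d / 2" for e
  proof -
    have "\<exists>g\<in>test_fns s U. gevrey_norm s p ?H U (\<lambda>x. f x - g x) < ennreal e"
      using f e(1) by (simp add: norm_closure_def)
    then obtain g where g: "g \<in> test_fns s U" and fg: "gevrey_norm s p ?H U (\<lambda>x. f x - g x) < ennreal e"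
      by (rule bexE)
    have gs: "g \<in> smooth_fns U" using g by (rule test_fns_smooth)
    have fgs: "(\<lambda>x. f x - g x) \<in> smooth_fns U"
      using smooth_lincomb[OF U(1) fs gs, of 1 "-1"] by simp
    have "gevrey_norm s p ?H U g \<le> gevrey_norm s p ?H U (\<lambda>x. f x - g x) + gevrey_norm s p ?H U f"
      by (rule le_diff_add)
    also have "\<dots> \<le> ennreal e + ennreal r"
      unfolding r(2) using fg by (intro add_right_mono less_imp_le)
    finally have gle: "gevrey_norm s p ?H U g \<le> ennreal (e + r)"
      using e r by (simp add: ennreal_plus)
    \<comment> \<open>On \<open>?A\<close> the derivative of \<open>f\<close> exceeds the bound by
      \<open>d\<close>, that of \<open>g\<close> by at most \<open>K * e\<close>, hence by at most
      half of \<open>d\<close>; the difference accounts for the rest.\<close>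
    have lower: "d / (2 * ?w) \<le> cmod (pds ?l (\<lambda>x. f x - g x) y)" if y: "y \<in> ?A" for y
    proof -
      have yU: "y \<in> U" using y by simp
      have "?w * cmod (pds ?l g y) \<le> K * (e + r)"
        unfolding K using e r by (intro test_fns_sup_le[OF U p h s g _ gle yU]) simp
      also have "\<dots> \<le> K * r + d / 2" using e(2) by (simp add: distrib_left)
      finally have "?w * cmod (pds ?l g y) \<le> K * r + d / 2" .
      moreover have "K * r + d < ?w * cmod (pds ?l f y)" using y by simp
      ultimately have "d / 2 \<le> ?w * (cmod (pds ?l f y) - cmod (pds ?l g y))"
        unfolding right_diff_distrib by linarith
      also have "\<dots> \<le> ?w * cmod (pds ?l (\<lambda>x. f x - g x) y)"
        using pds_lincomb[OF U(1) fs gs yU, of ?l 1 "-1"] w norm_triangle_ineq2[of "pds ?l f y" "pds ?l g y"]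
        by (intro mult_left_mono) simp_all
      finally show ?thesis using w by (simp add: field_simps)
    qed
    \<comment> \<open>Chebyshev's inequality for the derivative of \<open>f - g\<close>.\<close>
    have "ennreal ((d / (2 * ?w)) powr ?p) * emeasure lborel ?A =
        (\<integral>\<^sup>+y. ennreal ((d / (2 * ?w)) powr ?p) * indicator ?A y \<partial>restrict_space lborel U)"
    proof -
      have "?A \<in> sets (restrict_space lborel U)"
        using A U by (subst sets_restrict_space_iff) (simp_all add: subset_iff)
      moreover have "emeasure (restrict_space lborel U) ?A = emeasure lborel ?A"
        using U by (intro emeasure_restrict_space) (simp_all add: subset_iff)
      ultimately show ?thesis by (simp add: nn_integral_cmult_indicator)
    qed
    also have "\<dots> \<le> pow_integral ?p U (pds ?l (\<lambda>x. f x - g x))"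
      unfolding pow_integral_def
    proof (rule nn_integral_mono)
      fix y
      have "(d / (2 * ?w)) powr ?p \<le> cmod (pds ?l (\<lambda>x. f x - g x) y) powr ?p" if "y \<in> ?A"
        using lower[OF that] d w p1 by (intro powr_mono2) simp_all
      then show "ennreal ((d / (2 * ?w)) powr ?p) * indicator ?A y \<le>
          ennreal (cmod (pds ?l (\<lambda>x. f x - g x) y) powr ?p)"
        by (cases "y \<in> ?A") (simp_all add: ennreal_leI)
    qed
    also have "\<dots> \<le> ennreal ((e / ?W) powr ?p)"
      using e by (intro gevrey_norm_pow_integral_le[OF U(1) p H] less_imp_le[OF fg]) simp
    finally have "emeasure lborel ?A \<le> ennreal ((e / ?W) powr ?p / (d / (2 * ?w)) powr ?p)"
      using d w by (subst (asm) ennreal_mult_le_iff) simp_all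
    also have "(e / ?W) powr ?p / (d / (2 * ?w)) powr ?p = (C * e) powr ?p"
      using d w e by (simp add: C_def mult.commute flip: powr_divide)
    finally show ?thesis .
  qed
  have "emeasure lborel ?A = 0"
  proof (rule ccontr)
    assume "emeasure lborel ?A \<noteq> 0"
    then obtain m where m: "0 < m" "emeasure lborel ?A = ennreal m"
      using fin by (cases "emeasure lborel ?A") (auto simp: less_le)
    \<comment> \<open>The first entry gives \<open>K * e \<le> d / 2\<close>; the second gives
      \<open>C * e \<le> m powr (1 / ?p) / 2\<close>, so that (C e)^p falls below
      \<open>m\<close>.\<close>
    define e where "e = min (d / (2 * K)) (m powr (1 / ?p) / (2 * C))"
    have e: "0 < e" using d Kpos m C by (simp add: e_def)
    have "e \<le> d / (2 * K)" by (simp add: e_def)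
    then have "K * e \<le> d / 2" using Kpos by (simp add: field_simps)
    then have "m \<le> (C * e) powr ?p"
      using small[OF e] m by (simp add: ennreal_le_iff)
    also have "\<dots> \<le> (m powr (1 / ?p) / 2) powr ?p"
    proof (rule powr_mono2)
      have "e \<le> m powr (1 / ?p) / (2 * C)" by (simp add: e_def)
      then show "C * e \<le> m powr (1 / ?p) / 2" using C by (simp add: field_simps)
    qed (use p1 C e in simp_all)
    also have "\<dots> < (m powr (1 / ?p)) powr ?p"
      using m p1 by (intro powr_less_mono2) simp_all
    also have "\<dots> = m" using m p1 by (simp add: powr_powr)
    finally show False by simp
  qed
  then have "?A \<in> null_sets lborel" using A by (simp add: null_sets_def)
  then have "AE y in lborel. y \<notin> ?A" by (rule AE_not_in)
  then have "AE y in lborel. y \<in> U \<longrightarrow> ?w * cmod (pds ?l f y) \<le> K * r + d"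
    by (rule eventually_mono) (simp add: not_less)
  then have "AE y in restrict_space lborel U. ?w * cmod (pds ?l f y) \<le> K * r + d"
    using U by (subst AE_restrict_space_iff) simp_all
  then show "?w * cmod (pds ?l f x) \<le> K * r + d"
    by (rule le_of_AE_le[OF U(1) cont _ x])
qed

lemma gevrey_norm_infinity_le:
  fixes U :: "(real^'n::{finite,linorder}) set"
  assumes U: "open U" "bounded U" and p: "1 \<le> p" "p < \<infinity>" and h: "0 < h" and s: "0 \<le> s"
  shows "\<exists>K>0. \<forall>f\<in>norm_closure (gevrey_norm s p (2 powr s * h) U) (test_fns s U).
     gevrey_norm s \<infinity> h U f \<le> ennreal K * gevrey_norm s p (2 powr s * h) U f"
proof -
  define K where "K = (measure lborel U + 1) / (2 powr s * h) ^ CARD('n)"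
  have "0 < measure lborel U + 1" by (simp add: add_nonneg_pos)
  then have K: "0 < K" using h by (simp add: K_def)
  have "gevrey_norm s \<infinity> h U f \<le> ennreal K * gevrey_norm s p (2 powr s * h) U f"
    if f: "f \<in> norm_closure (gevrey_norm s p (2 powr s * h) U) (test_fns s U)" for f
  proof -
    have fin: "gevrey_norm s p (2 powr s * h) U f < \<infinity>" using f by (simp add: norm_closure_def)
    then obtain r where r: "0 \<le> r" "gevrey_norm s p (2 powr s * h) U f = ennreal r"
      by (cases "gevrey_norm s p (2 powr s * h) U f") auto
    have "gevrey_norm s \<infinity> h U f \<le> ennreal (K * r)"
      using gevrey_norm_infinity_le_iff[OF U(1) gevrey_norm_smooth[OF fin] h, of "K * r" s]
        norm_closure_sup_le[OF U p h s f r K_def] K r by simp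
    then show ?thesis using K r by (simp add: ennreal_mult)
  qed
  then show ?thesis using K by blast
qed

section \<open>Identification with the spaces of the statement and conclusion\<close>

lemma gevrey_top_eq: "gevrey_top s p h U = norm_top (gevrey_norm s p h U)"
proof -
  \<comment> \<open>Finite norm forces smoothness, since the norm is infinite off
    \<open>smooth_fns U\<close>.\<close>
  have "gevrey_space s p h U = {f. gevrey_norm s p h U f < \<infinity>}"
    using gevrey_norm_smooth[of s p h U] unfolding gevrey_space_def by blast
  then show ?thesis by (simp add: gevrey_top_def norm_top_def)
qed

lemma B_top_eq: "B_top s p U = proj_top (\<lambda>h. gevrey_norm s p h U)"
proof -
  have "gevrey_space s p h U = {f. gevrey_norm s p h U f < \<infinity>}" for h
    using gevrey_norm_smooth[of s p h U] unfolding gevrey_space_def by blast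
  then show ?thesis by (simp add: B_top_def proj_top_def gevrey_top_eq)
qed

text \<open>The two spaces are equal as topologies on the same functions, so the identity serves as
  the isomorphism. The parameters are \<open>2 powr s * h\<close> in one direction and, as any
  larger value would do, \<open>h + 1\<close> in the other.\<close>

lemma B_closure_eq_infinity:
  fixes U :: "(real^'n::{finite,linorder}) set"
  assumes U: "open U" "bounded U" and s: "0 \<le> s" and p: "1 \<le> p" "p < \<infinity>"
  shows "B_closure s p U = B_closure s \<infinity> U"
  unfolding B_closure_def B_top_eq
proof (rule proj_closure_eq)
  have one: "1 \<le> (\<infinity> :: ennreal)" by simp
  show "ext_norm_family (\<lambda>h. gevrey_norm s p h U)" "ext_norm_family (\<lambda>h. gevrey_norm s \<infinity> h U)"
    by (rule ext_norm_family_gevrey[OF U(1) p(1)], rule ext_norm_family_gevrey[OF U(1) one])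
  show "(\<lambda>x. f x - g x) \<in> test_fns s U" if "f \<in> test_fns s U" "g \<in> test_fns s U" for f g
    by (rule test_fns_diff[OF U(1) that])
  fix h :: real assume h: "0 < h"
  show "gevrey_norm s p h U f < \<infinity>" if "f \<in> test_fns s U" for f
    by (rule test_fns_gevrey_norm[OF U p h that])
  show "gevrey_norm s \<infinity> h U f < \<infinity>" if "f \<in> test_fns s U" for f
    by (rule test_fns_gevrey_norm_infinity[OF U(1) h that])
  show "\<exists>h'>0. \<exists>K>0. \<forall>f\<in>norm_closure (gevrey_norm s p h' U) (test_fns s U).
      gevrey_norm s \<infinity> h U f \<le> ennreal K * gevrey_norm s p h' U f"
    using gevrey_norm_infinity_le[OF U p h s] h by (intro exI[of _ "2 powr s * h"]) simp
  have "h < h + 1" by simp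
  then show "\<exists>h'>0. \<exists>K>0. \<forall>f\<in>norm_closure (gevrey_norm s \<infinity> h' U) (test_fns s U).
      gevrey_norm s p h U f \<le> ennreal K * gevrey_norm s \<infinity> h' U f"
    using gevrey_norm_le_infinity[OF U p h, of "h + 1" s] h by (intro exI[of _ "h + 1"]) auto
qed

theorem proposition3p2:
  fixes U :: "(real^'n::{finite,linorder}) set" and s :: real
  assumes "s > 1" and "open U" and "bounded U"
  shows "(\<forall>(p::ennreal) (h::real) (h1::real). 1 \<le> p \<and> p < \<infinity> \<and> 0 < h \<and> h < h1 \<longrightarrow>
           continuous_map (gevrey_closure s \<infinity> h1 U) (gevrey_closure s p h U) (\<lambda>f. f) \<and>
           continuous_map (gevrey_closure s p (2 powr s * h) U) (gevrey_closure s \<infinity> h U) (\<lambda>f. f)) \<and>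
         (\<forall>X \<in> insert (B_dot s U) {D_Lp s p U | p. 1 \<le> p \<and> p < \<infinity>}.
          \<forall>Y \<in> insert (B_dot s U) {D_Lp s p U | p. 1 \<le> p \<and> p < \<infinity>}.
            lcs_isomorphic X Y)"
proof (intro conjI allI impI ballI)
  have s: "0 \<le> s" using assms(1) by simp
  note U = assms(2,3)
  have one: "1 \<le> (\<infinity> :: ennreal)" by simp
  {
    fix p :: ennreal and h h1 :: real
    assume "1 \<le> p \<and> p < \<infinity> \<and> 0 < h \<and> h < h1"
    then have p: "1 \<le> p" "p < \<infinity>" and h: "0 < h" "h < h1" "0 < h1" "0 < 2 powr s * h" by auto
    obtain K where K: "0 < K" "\<And>f. gevrey_norm s p h U f \<le> ennreal K * gevrey_norm s \<infinity> h1 U f"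
      using gevrey_norm_le_infinity[OF U p h(1,2), of s] by blast
    show "continuous_map (gevrey_closure s \<infinity> h1 U) (gevrey_closure s p h U) (\<lambda>f. f)"
      unfolding gevrey_closure_def gevrey_top_eq
      by (rule continuous_map_norm_closure[OF ext_norm_gevrey[OF U(1) h(3) one] ext_norm_gevrey[OF U(1) h(1) p(1)]
            test_fns_diff[OF U(1)] test_fns_gevrey_norm_infinity[OF U(1) h(3)] K])
    obtain K where K: "0 < K" "\<And>f. f \<in> norm_closure (gevrey_norm s p (2 powr s * h) U) (test_fns s U) \<Longrightarrow>
        gevrey_norm s \<infinity> h U f \<le> ennreal K * gevrey_norm s p (2 powr s * h) U f"
      using gevrey_norm_infinity_le[OF U p h(1) s] by blast
    show "continuous_map (gevrey_closure s p (2 powr s * h) U) (gevrey_closure s \<infinity> h U) (\<lambda>f. f)"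
      unfolding gevrey_closure_def gevrey_top_eq
      by (rule continuous_map_norm_closure[OF ext_norm_gevrey[OF U(1) h(4) p(1)] ext_norm_gevrey[OF U(1) h(1) one]
            test_fns_diff[OF U(1)] test_fns_gevrey_norm[OF U p h(4)] K])
  }
  fix X Y
  assume "X \<in> insert (B_dot s U) {D_Lp s p U | p. 1 \<le> p \<and> p < \<infinity>}"
    and "Y \<in> insert (B_dot s U) {D_Lp s p U | p. 1 \<le> p \<and> p < \<infinity>}"
  \<comment> \<open>Every space of the family coincides with the one for the supremum norm, so all
    pairs reduce to this one.\<close>
  then have "X = B_dot s U" "Y = B_dot s U"
    using B_closure_eq_infinity[OF U s] by auto
  moreover have "homeomorphic_map (B_dot s U) (B_dot s U) (\<lambda>f. f)"
    using homeomorphic_map_id[of "B_dot s U" "B_dot s U"] by (simp add: id_def)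
  ultimately show "lcs_isomorphic X Y"
    unfolding lcs_isomorphic_def by (intro exI[of _ "\<lambda>f. f"]) simp
qed

end
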